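(* Let $\lambda>0$, $\phi>0$, $\gamma\ge0$, $0<\rho\le1$, $\mu\in(0,1)$, and, if $\gamma\ne0$, let $0<\mu\lceil\gamma\rceil/\gamma-r\rho<1$ for all $r=0,\dots,\lceil\gamma\rceil$. The generalized fractional Poisson process $N(t)$, $t\ge0$, can be constructed as a renewal process with the following waiting times. Let the inter-event waiting times $T_j$, $j=1,2,\dots$, be i.i.d. random variables with probability density function $$f_{T_j}(t)=\lambda t^{\mu-1}\sum_{r=0}^{\infty}(-\lambda t^{\mu})^r\,E^{\gamma r+\gamma}_{\rho,\mu r+\mu}(-\phi t^{\rho}),\qquad t\ge 0,$$ and Laplace transform $$\mathbb{E}\exp(-sT_j)=\frac{\lambda}{s^{\mu}(1+\phi s^{-\rho})^{\gamma}+\lambda},\qquad \left|-\lambda s^{-\mu}(1+\phi s^{-\rho})^{-\gamma}\right|<1,$$ and let $\mathcal{T}_m=T_1+T_2+\dots+T_m$ be the waiting time of the $m$th renewal event ($\mathcal{T}_0=0$). Then, for $k\ge 0$, $$\Pr(N(t)=k)=\Pr(\mathcal{T}_k<t)-\Pr(\mathcal{T}_{k+1}<t).$$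
   Context: The three-parameter Mittag--Leffler function is $E^{\gamma}_{\rho,\mu}(x)=\sum_{k=0}^{\infty}\frac{\Gamma(\gamma+k)}{\Gamma(\gamma)\Gamma(\rho k+\mu)}\frac{x^k}{k!}$, where $\Gamma(\gamma+k)/\Gamma(\gamma)$ is read as $\gamma(\gamma+1)\cdots(\gamma+k-1)$ (so that $E^0_{\rho,\mu}(x)=1/\Gamma(\mu)$). The generalized fractional Poisson process $N(t)$, $t\ge 0$, is the counting process with state probabilities $$\Pr(N(t)=k)=p_k(t)=\sum_{r=k}^{\infty}(-1)^{r-k}\binom{r}{k}(\lambda t^{\mu})^r\,E^{\gamma r}_{\rho,\mu r+1}(-\phi t^{\rho}),\qquad k\ge0,\ t\ge0.$$
   Formalization: The identity Pr(N(t)=k)=Pr(𝒯_k<t)−Pr(𝒯_{k+1}<t) is stated for all k≥0, t≥0 except k=t=0, where it fails: Pr(N(0)=0)=1, while Pr(𝒯_0<0)−Pr(𝒯_1<0)=0. *)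

theory Defs
  imports "HOL-Probability.Probability"
begin

text \<open>The quotient \<open>\<Gamma>(\<gamma> + k) / \<Gamma>(\<gamma>)\<close> is the rising factorial, so that \<open>\<gamma> = 0\<close> is admissible.\<close>

definition mittag_leffler3 :: "real \<Rightarrow> real \<Rightarrow> real \<Rightarrow> real \<Rightarrow> real" where
  "mittag_leffler3 \<gamma> \<rho> \<mu> x =
     (\<Sum>k. pochhammer \<gamma> k / Gamma (\<rho> * real k + \<mu>) * (x ^ k / fact k))"

text \<open>The series over \<open>r \<ge> k\<close> is indexed by \<open>i = r - k\<close>.\<close>

definition gfpp_state_prob ::
    "real \<Rightarrow> real \<Rightarrow> real \<Rightarrow> real \<Rightarrow> real \<Rightarrow> nat \<Rightarrow> real \<Rightarrow> real" where
  "gfpp_state_prob lam \<phi> \<gamma> \<rho> \<mu> k t =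
     (\<Sum>i. let r = k + i in
        (-1) ^ i * real (r choose k) * (lam * t powr \<mu>) ^ r *
        mittag_leffler3 (\<gamma> * real r) \<rho> (\<mu> * real r + 1) (- \<phi> * t powr \<rho>))"

text \<open>
  Only the one-dimensional distributions of a generalized fractional Poisson process are
  prescribed. Counts take values in \<^typ>\<open>enat\<close> so that a renewal count is defined on every
  path; they are required to be finite almost surely.
\<close>

definition is_gfpp ::
    "real \<Rightarrow> real \<Rightarrow> real \<Rightarrow> real \<Rightarrow> real \<Rightarrow> 'a measure \<Rightarrow> (real \<Rightarrow> 'a \<Rightarrow> enat) \<Rightarrow> bool" where
  "is_gfpp lam \<phi> \<gamma> \<rho> \<mu> M N \<longleftrightarrow>
     prob_space M \<and>
     (\<forall>t\<ge>0. N t \<in> measurable M (count_space UNIV)) \<and>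
     (AE \<omega> in M. (\<forall>t\<ge>0. N t \<omega> \<noteq> \<infinity>) \<and>
                  (\<forall>s t. 0 \<le> s \<and> s \<le> t \<longrightarrow> N s \<omega> \<le> N t \<omega>)) \<and>
     (\<forall>k. \<forall>t\<ge>0. measure M {\<omega> \<in> space M. N t \<omega> = enat k} = gfpp_state_prob lam \<phi> \<gamma> \<rho> \<mu> k t)"

text \<open>
  Extended by 0 to the negative half-line. The value at \<open>t = 0\<close>, where the series formula is
  singular, is 0 by the convention \<open>0 powr (\<mu> - 1) = 0\<close>.
\<close>

definition waiting_density :: "real \<Rightarrow> real \<Rightarrow> real \<Rightarrow> real \<Rightarrow> real \<Rightarrow> real \<Rightarrow> real" where
  "waiting_density lam \<phi> \<gamma> \<rho> \<mu> t =
     (if t < 0 then 0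
      else lam * t powr (\<mu> - 1) *
        (\<Sum>r. (- lam * t powr \<mu>) ^ r *
           mittag_leffler3 (\<gamma> * real r + \<gamma>) \<rho> (\<mu> * real r + \<mu>) (- \<phi> * t powr \<rho>)))"

text \<open>Waiting times are indexed by \<open>j = 1, 2, \<dots>\<close>; the value at index 0 is irrelevant.\<close>

definition iid_waiting_times :: "(real \<Rightarrow> real) \<Rightarrow> 'a measure \<Rightarrow> (nat \<Rightarrow> 'a \<Rightarrow> real) \<Rightarrow> bool" where
  "iid_waiting_times f M T \<longleftrightarrow>
     prob_space M \<and>
     prob_space.indep_vars M (\<lambda>_. borel) T {1..} \<and>
     (\<forall>j\<ge>1. distributed M lborel (T j) (\<lambda>t. ennreal (f t)))"

definition renewal_time :: "(nat \<Rightarrow> 'a \<Rightarrow> real) \<Rightarrow> nat \<Rightarrow> 'a \<Rightarrow> real" where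
  "renewal_time T m \<omega> = (\<Sum>j=1..m. T j \<omega>)"

definition renewal_count :: "(nat \<Rightarrow> 'a \<Rightarrow> real) \<Rightarrow> real \<Rightarrow> 'a \<Rightarrow> enat" where
  "renewal_count T t \<omega> = (SUP m \<in> {m. renewal_time T m \<omega> \<le> t}. enat m)"

end

theory Submission
  imports Defs "HOL-Complex_Analysis.Conformal_Mappings"
begin

text \<open>
  Write \<open>\<psi>(s) = s\<^sup>\<mu> (1 + \<phi> s\<^sup>-\<^sup>\<rho>)\<^sup>\<gamma>\<close> and \<open>F = \<lambda> / (\<psi> + \<lambda>)\<close>. Every claim is read off from Laplace
  transforms.

  For large \<open>s\<close> the double series of the density \<open>f\<close> and of the state probability \<open>p\<^sub>k\<close> may be
  transformed term by term (\<open>has_laplace_suminf\<close>). The binomial series then sums the inner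
  Mittag-Leffler series, a geometric and a negative binomial series sum the outer ones, and the
  results are \<open>F\<close> and \<open>(F\<^sup>k - F\<^sup>k\<^sup>+\<^sup>1) / s\<close> (\<open>has_laplace_dens\<close>, \<open>has_laplace_state\<close>).

  That \<open>f \<ge> 0\<close> is where the conditions on the exponents enter. With \<open>n = \<lceil>\<gamma>\<rceil> \<ge> 1\<close> they say that
  \<open>\<psi>\<close> is the power \<open>\<gamma>/n \<le> 1\<close> of a positive combination of powers \<open>s\<^sup>a\<close> with \<open>0 < a < 1\<close>
  (\<open>symbol_representation\<close>). For \<open>\<gamma> = 0\<close> it is \<open>s\<^sup>\<mu>\<close> itself.
  Hence \<open>\<psi>\<close> is a Bernstein function and \<open>F\<close> is completely monotone, so
  all the integrals of \<open>t\<^sup>n e\<^sup>-\<^sup>s\<^sup>t f(t)\<close> are nonnegative. The weights \<open>t\<^sup>n e\<^sup>-\<^sup>s\<^sup>t\<close> with \<open>n = s t\<^sub>0\<close>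
  concentrate at \<open>t\<^sub>0\<close>, so a continuous \<open>f\<close> cannot be negative at \<open>t\<^sub>0\<close>
  (\<open>moments_nonneg_imp_nonneg\<close>). The same concentration argument, applied to a difference and its
  negative, shows that a continuous function is determined by its Laplace transform
  (\<open>laplace_zero_imp_zero\<close>).

  Once \<open>f\<close> is nonnegative, the Taylor expansion of the completely monotone \<open>F\<close> around a large
  point bounds the transform of \<open>f\<close> at every positive argument (\<open>alternating_laplace_extend\<close>). The
  transform of \<open>f\<close> is therefore holomorphic in the right half-plane, and by the identity theorem
  its product with \<open>\<psi> + \<lambda>\<close> is the constant \<open>\<lambda>\<close> there (\<open>claplace_eq\<close>). Letting \<open>s\<close> tend to 0 gives
  total mass 1.

  For the renewal process, \<open>P(N(t) = k) = P(S\<^sub>k \<le> t) - P(S\<^sub>k\<^sub>+\<^sub>1 \<le> t)\<close>, and by independence this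
  function of \<open>t\<close> also has the transform \<open>(F\<^sup>k - F\<^sup>k\<^sup>+\<^sup>1) / s\<close>. Both it and \<open>p\<^sub>k\<close> are continuous for
  \<open>t > 0\<close>, hence equal (\<open>state_eq_cdf_diff\<close>). Strict and weak inequalities can be interchanged
  because the renewal times have densities.
\<close>

section \<open>Laplace transforms of absolutely convergent series\<close>

abbreviation pos_line :: "real measure" where
  "pos_line \<equiv> restrict_space lborel {0<..}"

lemma space_pos_line [simp]: "space pos_line = {0<..}"
  by (simp add: space_restrict_space)

lemma borel_measurable_pos_line:
  fixes h :: "real \<Rightarrow> 'b::topological_space"
  assumes "continuous_on {0<..} h"
  shows "h \<in> borel_measurable pos_line"
proof -
  have "h \<in> borel_measurable (restrict_space borel {0<..})"
    using assms by (rule borel_measurable_continuous_on_restrict)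
  moreover have "sets pos_line = sets (restrict_space borel {0<..})"
    by (simp add: sets_restrict_space)
  ultimately show ?thesis
    by (metis measurable_cong_sets)
qed

lemma has_bochner_integral_pos_line_gamma:
  fixes a s :: real
  assumes a: "0 < a" and s: "0 < s"
  shows "has_bochner_integral pos_line (\<lambda>t. exp (- s * t) * t powr (a - 1)) (Gamma a / s powr a)"
proof -
  have "ennreal (Gamma a) =
      (\<integral>\<^sup>+t. ennreal (indicator {0..} t * t powr (a - 1) / exp t) \<partial>lborel)"
    using a by (rule Gamma_conv_nn_integral_real)
  also have "\<dots> = ennreal s * (\<integral>\<^sup>+t. ennreal (indicator {0..} (s * t) * (s * t) powr (a - 1) / exp (s * t)) \<partial>lborel)"
    using s by (subst nn_integral_real_affine[where c = s and t = 0]) auto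
  also have "\<dots> = (\<integral>\<^sup>+t. ennreal (s powr a) * (ennreal (exp (- s * t) * t powr (a - 1)) * indicator {0<..} t) \<partial>lborel)"
  proof -
    have "ennreal s * ennreal (indicator {0..} (s * t) * (s * t) powr (a - 1) / exp (s * t)) =
        ennreal (s powr a) * (ennreal (exp (- s * t) * t powr (a - 1)) * indicator {0<..} t)" for t
    proof (cases "0 < t")
      case True
      have "s * ((s * t) powr (a - 1) / exp (s * t)) = s powr a * (exp (- s * t) * t powr (a - 1))"
        using s True by (simp add: powr_mult powr_diff exp_minus field_simps)
      then show ?thesis
        using s True by (simp add: ennreal_mult'[symmetric] indicator_def)
    next
      case False
      then show ?thesis
        using s by (cases "t = 0") (auto simp: indicator_def mult_less_0_iff zero_le_mult_iff)
    qed
    then show ?thesis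
      by (subst nn_integral_cmult[symmetric]) auto
  qed
  also have "\<dots> = ennreal (s powr a) * (\<integral>\<^sup>+t. ennreal (exp (- s * t) * t powr (a - 1)) \<partial>pos_line)"
    by (subst nn_integral_cmult) (auto simp: nn_integral_restrict_space)
  finally have eq: "ennreal (Gamma a) =
      ennreal (s powr a) * (\<integral>\<^sup>+t. ennreal (exp (- s * t) * t powr (a - 1)) \<partial>pos_line)" .
  have "(\<integral>\<^sup>+t. ennreal (exp (- s * t) * t powr (a - 1)) \<partial>pos_line) = ennreal (Gamma a / s powr a)"
  proof -
    have "ennreal (inverse (s powr a)) * ennreal (Gamma a) =
        (ennreal (inverse (s powr a)) * ennreal (s powr a)) *
        (\<integral>\<^sup>+t. ennreal (exp (- s * t) * t powr (a - 1)) \<partial>pos_line)"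
      by (subst eq) (simp add: mult.assoc)
    also have "ennreal (inverse (s powr a)) * ennreal (s powr a) = 1"
      using s by (simp add: ennreal_mult'[symmetric])
    finally show ?thesis
      using a s by (simp add: ennreal_mult'[symmetric] divide_inverse mult.commute)
  qed
  then show ?thesis
    using a s
    by (intro has_bochner_integral_nn_integral borel_measurable_pos_line continuous_intros) 
       (auto intro!: Gamma_real_pos divide_nonneg_nonneg less_imp_le)
qed

text \<open>
  The part of the Gamma integral over \<open>{t..t+1}\<close> already bounds \<open>t powr (a - 1)\<close>. The point of the
  bound is that its right-hand side is a factor independent of \<open>a\<close> times the Laplace transform of
  the monomial, so convergence of a series of transforms forces locally uniform convergence of
  the series itself, without any asymptotics of the Gamma function.
\<close>

lemma powr_le_Gamma:
  fixes a s t :: real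
  assumes a: "0 < a" and s: "0 < s" and t: "0 < t"
  shows "t powr (a - 1) \<le> exp (s * (t + 1)) * (1 + 1 / t) * (Gamma a / s powr a)"
proof -
  define q where "q = t / (t + 1) * t powr (a - 1) * exp (- s * (t + 1))"
  have hb: "has_bochner_integral pos_line (\<lambda>u. exp (- s * u) * u powr (a - 1)) (Gamma a / s powr a)"
    by (rule has_bochner_integral_pos_line_gamma[OF a s])
  have em: "emeasure pos_line {t..t+1} = 1"
    using t by (subst emeasure_restrict_space) auto
  have sets: "{t..t+1} \<in> sets pos_line"
    using t by (auto simp: sets_restrict_space_iff)
  have m: "measure pos_line {t..t+1} = 1"
    using em by (simp add: measure_def)
  have "q = (\<integral>u. q * indicator {t..t+1} u \<partial>pos_line)"
  proof -
    have "{t..t+1} \<inter> {0<..} = {t..t+1}" using t by auto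
    then show ?thesis using m by simp
  qed
  also have "\<dots> \<le> (\<integral>u. exp (- s * u) * u powr (a - 1) \<partial>pos_line)"
  proof (rule integral_mono)
    show "integrable pos_line (\<lambda>u. q * indicator {t..t+1} u)"
      using em sets by (intro integrable_mult_right integrable_real_indicator) auto
    show "integrable pos_line (\<lambda>u. exp (- s * u) * u powr (a - 1))"
      using hb by (rule has_bochner_integral_iff[THEN iffD1, THEN conjunct1])
    fix u assume "u \<in> space pos_line"
    then have u: "0 < u" by simp
    show "q * indicator {t..t+1} u \<le> exp (- s * u) * u powr (a - 1)"
    proof (cases "u \<in> {t..t+1}")
      case True
      have "t / (t + 1) * t powr (a - 1) \<le> u powr (a - 1)"
      proof (cases "a \<ge> 1")
        case a1: True
        have "t / (t + 1) * t powr (a - 1) \<le> 1 * t powr (a - 1)"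
          using t by (intro mult_right_mono) auto
        also have "\<dots> \<le> u powr (a - 1)"
          using True t a1 by (simp add: powr_mono2)
        finally show ?thesis .
      next
        case False
        \<comment> \<open>For \<open>a < 1\<close> the integrand is smallest at the right endpoint \<open>t + 1\<close>.\<close>
        have "t / (t + 1) * t powr (a - 1) \<le> (t / (t + 1)) powr (1 - a) * t powr (a - 1)"
        proof (intro mult_right_mono)
          have "(t / (t + 1)) powr 1 \<le> (t / (t + 1)) powr (1 - a)"
            using t False a by (intro powr_mono') auto
          then show "t / (t + 1) \<le> (t / (t + 1)) powr (1 - a)"
            using t by simp
        qed simp
        also have "\<dots> = (t + 1) powr (a - 1)"
          using t by (simp add: powr_divide powr_minus_divide[of _ "1 - a", simplified] powr_minus_divide[of "t + 1" "1 - a"] flip: powr_add)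
        also have "\<dots> \<le> u powr (a - 1)"
          using True t False by (intro powr_mono2') auto
        finally show ?thesis .
      qed
      moreover have "exp (- s * (t + 1)) \<le> exp (- s * u)"
        using True s by auto
      ultimately have "t / (t + 1) * t powr (a - 1) * exp (- s * (t + 1)) \<le> u powr (a - 1) * exp (- s * u)"
        by (intro mult_mono) auto
      then show ?thesis
        using True by (simp add: q_def mult.commute)
    qed (simp add: u)
  qed
  also have "\<dots> = Gamma a / s powr a"
    using hb by (rule has_bochner_integral_integral_eq)
  finally have "t / (t + 1) * t powr (a - 1) * exp (- s * (t + 1)) \<le> Gamma a / s powr a"
    by (simp add: q_def)
  then have "(exp (s * (t + 1)) * (1 + 1 / t)) * (t / (t + 1) * t powr (a - 1) * exp (- s * (t + 1)))
      \<le> (exp (s * (t + 1)) * (1 + 1 / t)) * (Gamma a / s powr a)"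
    using t by (intro mult_left_mono) auto
  moreover have "(exp (s * (t + 1)) * (1 + 1 / t)) * (t / (t + 1) * t powr (a - 1) * exp (- s * (t + 1)))
      = (exp (s * (t + 1)) * exp (- s * (t + 1))) * (((1 + 1 / t) * (t / (t + 1))) * t powr (a - 1))"
    by (simp only: ac_simps)
  moreover have "(1 + 1 / t) * (t / (t + 1)) = 1"
  proof -
    have "1 + 1 / t = (t + 1) / t" using t by (simp add: field_simps)
    then show ?thesis using t by simp
  qed
  moreover have "exp (s * (t + 1)) * exp (- s * (t + 1)) = 1"
    by (simp add: exp_minus)
  ultimately show ?thesis by (metis mult_1)
qed

text \<open>
  Here \<open>L\<close> is the Laplace transform of \<open>h\<close> at \<open>s\<close> and \<open>B\<close> bounds that of \<open>\<bar>h\<bar>\<close>. The same \<open>B\<close> also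
  controls \<open>h\<close> pointwise, in the form given by \<open>powr_le_Gamma\<close>. Bundling the two bounds makes the
  predicate stable under series with summable \<open>B\<close>, and it can be iterated for double series.
\<close>

definition has_laplace :: "real \<Rightarrow> (real \<Rightarrow> real) \<Rightarrow> real \<Rightarrow> real \<Rightarrow> bool" where
  "has_laplace s h B L \<longleftrightarrow>
     continuous_on {0<..} h \<and>
     (\<forall>t>0. \<bar>h t\<bar> \<le> exp (s * (t + 1)) * (1 + 1 / t) * B) \<and>
     integrable pos_line (\<lambda>t. exp (- s * t) * h t) \<and>
     (\<integral>t. \<bar>exp (- s * t) * h t\<bar> \<partial>pos_line) \<le> B \<and>
     (\<integral>t. exp (- s * t) * h t \<partial>pos_line) = L"

lemma has_laplace_cong:
  assumes "\<And>t. 0 < t \<Longrightarrow> g t = h t"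
  shows "has_laplace s g B L \<longleftrightarrow> has_laplace s h B L"
proof -
  have "continuous_on {0<..} g \<longleftrightarrow> continuous_on {0<..} h"
    using assms by (intro continuous_on_cong) auto
  moreover have "integrable pos_line (\<lambda>t. exp (- s * t) * g t) \<longleftrightarrow> integrable pos_line (\<lambda>t. exp (- s * t) * h t)"
    using assms by (intro Bochner_Integration.integrable_cong) auto
  moreover have "(\<integral>t. \<bar>exp (- s * t) * g t\<bar> \<partial>pos_line) = (\<integral>t. \<bar>exp (- s * t) * h t\<bar> \<partial>pos_line)"
    using assms by (intro Bochner_Integration.integral_cong) auto
  moreover have "(\<integral>t. exp (- s * t) * g t \<partial>pos_line) = (\<integral>t. exp (- s * t) * h t \<partial>pos_line)"
    using assms by (intro Bochner_Integration.integral_cong) auto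
  ultimately show ?thesis
    using assms by (simp add: has_laplace_def)
qed

lemma has_laplace_powr:
  assumes a: "0 < a" and s: "0 < s"
  shows "has_laplace s (\<lambda>t. t powr (a - 1) / Gamma a) (s powr - a) (s powr - a)"
proof -
  have G: "Gamma a > 0" using a by (rule Gamma_real_pos)
  have hb: "has_bochner_integral pos_line (\<lambda>t. exp (- s * t) * t powr (a - 1) / Gamma a)
      (Gamma a / s powr a / Gamma a)"
    using has_bochner_integral_pos_line_gamma[OF a s] by (rule has_bochner_integral_divide_zero)
  have I: "integrable pos_line (\<lambda>t. exp (- s * t) * t powr (a - 1) / Gamma a)"
    and E: "(\<integral>t. exp (- s * t) * t powr (a - 1) / Gamma a \<partial>pos_line) = s powr - a"
    using hb G by (auto simp: has_bochner_integral_iff powr_minus divide_inverse)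
  have abs: "\<bar>exp (- s * t) * t powr (a - 1) / Gamma a\<bar> = exp (- s * t) * t powr (a - 1) / Gamma a" for t
    using G by simp
  have "\<bar>t powr (a - 1) / Gamma a\<bar> \<le> exp (s * (t + 1)) * (1 + 1 / t) * s powr - a" if "0 < t" for t
    using powr_le_Gamma[OF a s that] G by (simp add: powr_minus field_simps)
  moreover have "continuous_on {0<..} (\<lambda>t. t powr (a - 1) / Gamma a)"
    using G by (intro continuous_intros) auto
  ultimately show ?thesis
    using I E unfolding has_laplace_def times_divide_eq_right abs by simp
qed

lemma has_laplace_cmult:
  assumes "has_laplace s h B L"
  shows "has_laplace s (\<lambda>t. c * h t) (\<bar>c\<bar> * B) (c * L)"
proof -
  have 1: "\<bar>c * h t\<bar> \<le> exp (s * (t + 1)) * (1 + 1 / t) * (\<bar>c\<bar> * B)" if "0 < t" for t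
  proof -
    have "\<bar>c\<bar> * \<bar>h t\<bar> \<le> \<bar>c\<bar> * (exp (s * (t + 1)) * (1 + 1 / t) * B)"
      using assms that by (intro mult_left_mono) (auto simp: has_laplace_def)
    then show ?thesis by (simp add: abs_mult ac_simps)
  qed
  have "(\<integral>t. \<bar>c\<bar> * \<bar>exp (- s * t) * h t\<bar> \<partial>pos_line) \<le> \<bar>c\<bar> * B"
    using assms by (auto simp: has_laplace_def intro!: mult_left_mono)
  moreover have "(\<lambda>t. \<bar>exp (- s * t) * (c * h t)\<bar>) = (\<lambda>t. \<bar>c\<bar> * \<bar>exp (- s * t) * h t\<bar>)"
    by (auto simp: abs_mult)
  moreover have "(\<lambda>t. exp (- s * t) * (c * h t)) = (\<lambda>t. c * (exp (- s * t) * h t))"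
    by (auto simp: abs_mult)
  ultimately show ?thesis
    using assms 1 unfolding has_laplace_def
    by (auto intro!: continuous_intros)
qed

lemma has_laplace_summable:
  assumes h: "\<And>i::nat. has_laplace s (h i) (B i) (L i)" and B: "summable B" and t: "0 < t"
  shows "summable (\<lambda>i. \<bar>h i t\<bar>)"
proof (rule summable_comparison_test')
  show "summable (\<lambda>i. exp (s * (t + 1)) * (1 + 1 / t) * B i)"
    using B by (rule summable_mult)
  show "norm \<bar>h i t\<bar> \<le> exp (s * (t + 1)) * (1 + 1 / t) * B i" for i
    using h[of i] t by (auto simp: has_laplace_def)
qed

lemma has_laplace_bound_nonneg:
  assumes "has_laplace s h B L" shows "0 \<le> B" "\<bar>L\<bar> \<le> B"
proof -
  have "\<bar>L\<bar> \<le> (\<integral>t. \<bar>exp (- s * t) * h t\<bar> \<partial>pos_line)"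
    using integral_norm_bound[of pos_line "\<lambda>t. exp (- s * t) * h t"] assms
    unfolding has_laplace_def real_norm_def by auto
  then show *: "\<bar>L\<bar> \<le> B"
    using assms by (simp add: has_laplace_def)
  show "0 \<le> B" using * by simp
qed

text \<open>
  The pointwise bounds give uniform convergence on compact subsets of the open half-line, hence
  continuity of the sum; the integral bounds justify the interchange of sum and integral.
\<close>

lemma has_laplace_suminf:
  assumes h: "\<And>i::nat. has_laplace s (h i) (B i) (L i)" and B: "summable B" and s: "0 < s"
  shows "has_laplace s (\<lambda>t. \<Sum>i. h i t) (\<Sum>i. B i) (\<Sum>i. L i)"
proof -
  have B0: "0 \<le> B i" for i using h by (rule has_laplace_bound_nonneg)
  have hb: "\<bar>h i t\<bar> \<le> exp (s * (t + 1)) * (1 + 1 / t) * B i" if "0 < t" for i t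
    using h[of i] that by (auto simp: has_laplace_def)
  have sm: "summable (\<lambda>i. \<bar>h i t\<bar>)" if "0 < t" for t
    using has_laplace_summable[OF h B that] .
  have cont: "continuous_on {0<..} (\<lambda>t. \<Sum>i. h i t)"
  proof (subst continuous_on_eq_continuous_at)
    show "\<forall>x\<in>{0<..}. isCont (\<lambda>t. \<Sum>i. h i t) x"
    proof
      fix x :: real assume "x \<in> {0<..}"
      then have x: "0 < x" by simp
      let ?A = "{x/2<..<x+1}"
      have "uniform_limit ?A (\<lambda>n t. \<Sum>i<n. h i t) (\<lambda>t. \<Sum>i. h i t) sequentially"
      proof (rule Weierstrass_m_test)
        show "summable (\<lambda>i. exp (s * (x + 2)) * (1 + 2 / x) * B i)"
          using B by (rule summable_mult)
        fix i t assume t: "t \<in> ?A"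
        have "norm (h i t) \<le> exp (s * (t + 1)) * (1 + 1 / t) * B i"
          using hb[of t i] t x by simp
        also have "\<dots> \<le> exp (s * (x + 2)) * (1 + 2 / x) * B i"
        proof (intro mult_right_mono mult_mono)
          show "exp (s * (t + 1)) \<le> exp (s * (x + 2))"
            using t s by auto
          show "1 + 1 / t \<le> 1 + 2 / x"
            using t x by (auto simp: field_simps)
        qed (use t x B0 in auto)
        finally show "norm (h i t) \<le> exp (s * (x + 2)) * (1 + 2 / x) * B i" .
      qed
      moreover have "\<forall>\<^sub>F n in sequentially. continuous_on ?A (\<lambda>t. \<Sum>i<n. h i t)"
      proof (intro always_eventually allI continuous_on_sum)
        fix i
        have "continuous_on {0<..} (h i)" using h by (simp add: has_laplace_def)
        then show "continuous_on ?A (h i)"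
          by (rule continuous_on_subset) (use x in auto)
      qed
      ultimately have "continuous_on ?A (\<lambda>t. \<Sum>i. h i t)"
        by (intro uniform_limit_theorem) auto
      then show "isCont (\<lambda>t. \<Sum>i. h i t) x"
        using x by (subst (asm) continuous_on_eq_continuous_at) auto
    qed
  qed simp
  have sm': "summable (\<lambda>i. norm (exp (- s * t) * h i t))" if "0 < t" for t
    using summable_mult[OF sm[OF that], of "exp (- s * t)"] by (simp add: abs_mult)
  have ae: "AE t in pos_line. summable (\<lambda>i. norm (exp (- s * t) * h i t))"
    by (rule AE_I2) (use sm' in simp)
  have int: "integrable pos_line (\<lambda>t. exp (- s * t) * h i t)" for i
    using h by (simp add: has_laplace_def)
  have nb: "(\<integral>t. norm (exp (- s * t) * h i t) \<partial>pos_line) \<le> B i" for i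
    using h[of i] by (simp add: has_laplace_def)
  have smi: "summable (\<lambda>i. \<integral>t. norm (exp (- s * t) * h i t) \<partial>pos_line)"
    by (rule summable_comparison_test'[OF B]) (use nb in simp)
  have eq: "(\<Sum>i. exp (- s * t) * h i t) = exp (- s * t) * (\<Sum>i. h i t)" if "0 < t" for t
    by (rule suminf_mult) (use sm[OF that] in \<open>rule summable_rabs_cancel\<close>)
  have int_sum: "integrable pos_line (\<lambda>t. exp (- s * t) * (\<Sum>i. h i t))"
    using integrable_suminf[OF int ae smi] eq
    by (subst (asm) Bochner_Integration.integrable_cong) auto
  have L: "(\<integral>t. exp (- s * t) * (\<Sum>i. h i t) \<partial>pos_line) = (\<Sum>i. L i)"
  proof -
    have "(\<integral>t. exp (- s * t) * (\<Sum>i. h i t) \<partial>pos_line) = (\<integral>t. (\<Sum>i. exp (- s * t) * h i t) \<partial>pos_line)"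
      using eq by (intro Bochner_Integration.integral_cong) auto
    also have "\<dots> = (\<Sum>i. \<integral>t. exp (- s * t) * h i t \<partial>pos_line)"
      using integral_suminf[OF int ae smi] .
    also have "\<dots> = (\<Sum>i. L i)"
      using h by (simp add: has_laplace_def)
    finally show ?thesis .
  qed
  have Bd: "(\<integral>t. \<bar>exp (- s * t) * (\<Sum>i. h i t)\<bar> \<partial>pos_line) \<le> (\<Sum>i. B i)"
  proof -
    have int': "integrable pos_line (\<lambda>t. norm (exp (- s * t) * h i t))" for i
      using int by (rule integrable_norm)
    have ae': "AE t in pos_line. summable (\<lambda>i. norm (norm (exp (- s * t) * h i t)))"
      using ae by simp
    have smi': "summable (\<lambda>i. \<integral>t. norm (norm (exp (- s * t) * h i t)) \<partial>pos_line)"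
      using smi by simp
    have "(\<integral>t. \<bar>exp (- s * t) * (\<Sum>i. h i t)\<bar> \<partial>pos_line) \<le>
        (\<integral>t. (\<Sum>i. norm (exp (- s * t) * h i t)) \<partial>pos_line)"
    proof (rule integral_mono)
      show "integrable pos_line (\<lambda>t. \<bar>exp (- s * t) * (\<Sum>i. h i t)\<bar>)"
        using int_sum by (rule integrable_abs)
      show "integrable pos_line (\<lambda>t. \<Sum>i. norm (exp (- s * t) * h i t))"
        by (rule integrable_suminf[OF int' ae' smi'])
      fix t assume "t \<in> space pos_line"
      then have t: "0 < t" by simp
      show "\<bar>exp (- s * t) * (\<Sum>i. h i t)\<bar> \<le> (\<Sum>i. norm (exp (- s * t) * h i t))"
        using summable_norm[OF sm'[OF t]] eq[OF t] by simp
    qed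
    also have "\<dots> = (\<Sum>i. \<integral>t. norm (exp (- s * t) * h i t) \<partial>pos_line)"
      by (rule integral_suminf[OF int' ae' smi'])
    also have "\<dots> \<le> (\<Sum>i. B i)"
      using nb smi B by (intro suminf_le) auto
    finally show ?thesis .
  qed
  have "\<bar>\<Sum>i. h i t\<bar> \<le> exp (s * (t + 1)) * (1 + 1 / t) * (\<Sum>i. B i)" if t: "0 < t" for t
  proof -
    have "\<bar>\<Sum>i. h i t\<bar> \<le> (\<Sum>i. \<bar>h i t\<bar>)"
      using sm[OF t] by (rule summable_rabs)
    also have "\<dots> \<le> (\<Sum>i. exp (s * (t + 1)) * (1 + 1 / t) * B i)"
      using hb[OF t] sm[OF t] B by (intro suminf_le summable_mult) auto
    also have "\<dots> = exp (s * (t + 1)) * (1 + 1 / t) * (\<Sum>i. B i)"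
      using B by (rule suminf_mult)
    finally show ?thesis .
  qed
  then show ?thesis
    using cont int_sum L Bd unfolding has_laplace_def by blast
qed

section \<open>Transforms of the waiting-time density and of the state probabilities\<close>

lemma pochhammer_nonneg: "0 \<le> a \<Longrightarrow> 0 \<le> pochhammer (a::real) n"
  by (auto simp: pochhammer_prod intro!: prod_nonneg)

text \<open>
  The coefficients are those in the three-parameter Mittag-Leffler series, which is why its
  transform has a closed form.
\<close>

lemma binomial_series_neg:
  fixes g x :: real
  assumes "\<bar>x\<bar> < 1"
  shows "(\<lambda>k. pochhammer g k / fact k * x ^ k) sums (1 - x) powr - g"
proof -
  have "(\<lambda>n. (- g gchoose n) * (- x) ^ n) sums (1 + - x) powr - g"
    using assms by (intro Generalised_Binomial_Theorem.gen_binomial_real) simp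
  moreover have "(- g gchoose n) * (- x) ^ n = pochhammer g n / fact n * x ^ n" for n
  proof -
    have "(- 1) ^ n * (- x) ^ n = x ^ n"
      by (simp flip: power_mult_distrib)
    then show ?thesis by (simp add: gbinomial_pochhammer mult_ac)
  qed
  ultimately show ?thesis by simp
qed

lemma has_laplace_mittag_leffler3:
  fixes s g \<rho> b \<phi> :: real
  assumes s: "0 < s" and g: "0 \<le> g" and \<rho>: "0 < \<rho>" and b: "0 < b" and \<phi>: "0 < \<phi>"
    and small: "\<phi> * s powr - \<rho> < 1"
  shows "has_laplace s (\<lambda>t. t powr (b - 1) * mittag_leffler3 g \<rho> b (- \<phi> * t powr \<rho>))
    (s powr - b * (1 - \<phi> * s powr - \<rho>) powr - g)
    (s powr - b * (1 + \<phi> * s powr - \<rho>) powr - g)"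
proof -
  define x where "x = \<phi> * s powr - \<rho>"
  have x: "0 \<le> x" "x < 1" using small \<phi> by (auto simp: x_def)
  define c where "c k = pochhammer g k / fact k * (- \<phi>) ^ k" for k
  define a where "a k = \<rho> * real k + b" for k
  have a: "0 < a k" for k using \<rho> b by (auto simp: a_def add_nonneg_pos)
  define h where "h k t = c k * (t powr (a k - 1) / Gamma (a k))" for k t
  have spow: "s powr - a k = s powr - b * (s powr - \<rho>) ^ k" for k
    using s by (simp add: a_def powr_add powr_powr flip: powr_realpow) (simp add: mult_ac powr_diff powr_minus divide_inverse)
  have Bk: "\<bar>c k\<bar> * s powr - a k = s powr - b * (pochhammer g k / fact k * x ^ k)" for k
    using \<phi> pochhammer_nonneg[OF g]
    by (simp add: c_def x_def spow abs_mult power_abs power_mult_distrib)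
  have Lk: "c k * s powr - a k = s powr - b * (pochhammer g k / fact k * (- x) ^ k)" for k
    by (simp add: c_def x_def spow flip: power_mult_distrib)
  have hk: "has_laplace s (h k) (\<bar>c k\<bar> * s powr - a k) (c k * s powr - a k)" for k
    unfolding h_def by (intro has_laplace_cmult has_laplace_powr a s)
  have B: "(\<lambda>k. \<bar>c k\<bar> * s powr - a k) sums (s powr - b * (1 - x) powr - g)"
    unfolding Bk using x by (intro sums_mult binomial_series_neg) auto
  have L: "(\<lambda>k. c k * s powr - a k) sums (s powr - b * (1 - - x) powr - g)"
    unfolding Lk using x by (intro sums_mult binomial_series_neg) auto
  have "has_laplace s (\<lambda>t. \<Sum>k. h k t) (s powr - b * (1 - x) powr - g) (s powr - b * (1 + x) powr - g)"
    using has_laplace_suminf[OF hk sums_summable[OF B] s] B L by (simp add: sums_iff)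
  moreover have "(\<Sum>k. h k t) = t powr (b - 1) * mittag_leffler3 g \<rho> b (- \<phi> * t powr \<rho>)" if t: "0 < t" for t
  proof -
    have h: "h k t = t powr (b - 1) *
        (pochhammer g k / Gamma (\<rho> * real k + b) * ((- \<phi> * t powr \<rho>) ^ k / fact k))" for k
    proof -
      have "t powr (a k - 1) = t powr (b - 1) * (t powr \<rho>) ^ k"
        using t by (simp add: a_def powr_powr algebra_simps flip: powr_realpow powr_add)
      moreover have "(- \<phi> * t powr \<rho>) ^ k = (- \<phi>) ^ k * (t powr \<rho>) ^ k"
        by (rule power_mult_distrib)
      ultimately show ?thesis
        unfolding h_def c_def by (simp add: a_def mult_ac)
    qed
    have "summable (\<lambda>k. h k t)"
      using has_laplace_summable[OF hk sums_summable[OF B] t] by (rule summable_rabs_cancel)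
    then have "summable (\<lambda>k. pochhammer g k / Gamma (\<rho> * real k + b) * ((- \<phi> * t powr \<rho>) ^ k / fact k))"
      unfolding h using t by (subst (asm) summable_cmult_iff) auto
    then show ?thesis
      unfolding h mittag_leffler3_def by (rule suminf_mult)
  qed
  ultimately show ?thesis
    by (subst has_laplace_cong[where h = "\<lambda>t. \<Sum>k. h k t"]) (auto simp: x_def)
qed

locale gfpp_params =
  fixes lam \<phi> \<gamma> \<rho> \<mu> :: real
  assumes lam: "0 < lam" and \<phi>: "0 < \<phi>" and \<gamma>: "0 \<le> \<gamma>" and \<rho>: "0 < \<rho>" "\<rho> \<le> 1" and \<mu>: "0 < \<mu>" "\<mu> < 1"
    and exponents: "\<gamma> \<noteq> 0 \<longrightarrow> (\<forall>r::nat. int r \<le> \<lceil>\<gamma>\<rceil> \<longrightarrow>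
           0 < \<mu> * of_int \<lceil>\<gamma>\<rceil> / \<gamma> - real r * \<rho> \<and> \<mu> * of_int \<lceil>\<gamma>\<rceil> / \<gamma> - real r * \<rho> < 1)"
begin

text \<open>
  The function \<open>\<psi>\<close> of the introduction, on the positive half-line.
\<close>

definition symbol :: "real \<Rightarrow> real" where
  "symbol s = s powr \<mu> * (1 + \<phi> * s powr - \<rho>) powr \<gamma>"

definition density_transform :: "real \<Rightarrow> real" where
  "density_transform s = lam / (symbol s + lam)"

abbreviation dens :: "real \<Rightarrow> real" where
  "dens \<equiv> waiting_density lam \<phi> \<gamma> \<rho> \<mu>"

abbreviation state :: "nat \<Rightarrow> real \<Rightarrow> real" where
  "state \<equiv> gfpp_state_prob lam \<phi> \<gamma> \<rho> \<mu>"

lemma symbol_pos: "0 < s \<Longrightarrow> 0 < symbol s"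
  using \<phi> by (simp add: symbol_def add_pos_nonneg less_imp_neq[THEN not_sym])

text \<open>
  The last two conditions make the binomial and the geometric series converge absolutely: the
  alternating inner series sums to \<open>(1 + \<phi> s powr - \<rho>) powr - \<gamma>\<close>, its absolute values to
  \<open>(1 - \<phi> s powr - \<rho>) powr - \<gamma>\<close>.
\<close>

definition in_expansion_range :: "real \<Rightarrow> bool" where
  "in_expansion_range s \<longleftrightarrow> 0 < s \<and> \<phi> * s powr - \<rho> < 1 \<and>
     lam * s powr - \<mu> * (1 - \<phi> * s powr - \<rho>) powr - \<gamma> < 1"

lemma eventually_in_expansion_range: "\<exists>c>0. \<forall>s>c. in_expansion_range s"
proof -
  have "((\<lambda>s. \<phi> * s powr - \<rho>) \<longlongrightarrow> \<phi> * 0) at_top"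
    using \<rho> by (intro tendsto_intros tendsto_neg_powr filterlim_ident) auto
  then have 1: "((\<lambda>s. \<phi> * s powr - \<rho>) \<longlongrightarrow> 0) at_top" by simp
  have "((\<lambda>s. lam * s powr - \<mu> * (1 - \<phi> * s powr - \<rho>) powr - \<gamma>) \<longlongrightarrow> lam * 0 * (1 - 0) powr - \<gamma>) at_top"
    using \<mu> by (intro tendsto_intros tendsto_neg_powr filterlim_ident 1) auto
  then have 2: "((\<lambda>s. lam * s powr - \<mu> * (1 - \<phi> * s powr - \<rho>) powr - \<gamma>) \<longlongrightarrow> 0) at_top" by simp
  have "eventually in_expansion_range at_top"
    using eventually_gt_at_top[of 0] order_tendstoD(2)[OF 1 zero_less_one] order_tendstoD(2)[OF 2 zero_less_one]
    unfolding in_expansion_range_def by eventually_elim simp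
  then obtain N where N: "\<forall>s\<ge>N. in_expansion_range s" by (auto simp: eventually_at_top_linorder)
  then have "\<forall>s>max 1 N. in_expansion_range s" by simp
  then show ?thesis by (metis less_max_iff_disj zero_less_one)
qed

text \<open>
  Both families of series in the theorem are built from these terms. Splitting off \<open>s powr - d\<close>
  exhibits the dependence on \<open>m\<close> as an \<open>m\<close>-th power.
\<close>

lemma has_laplace_ml_power:
  assumes s: "in_expansion_range s" and b: "b = \<mu> * real m + d" "0 < b"
  shows "has_laplace s (\<lambda>t. t powr (b - 1) * mittag_leffler3 (\<gamma> * real m) \<rho> b (- \<phi> * t powr \<rho>))
    (s powr - d * (s powr - \<mu> * (1 - \<phi> * s powr - \<rho>) powr - \<gamma>) ^ m)
    (s powr - d * (inverse (symbol s)) ^ m)"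
proof -
  have s0: "0 < s" and sm: "\<phi> * s powr - \<rho> < 1" using s by (auto simp: in_expansion_range_def)
  have sp: "s powr - b = s powr - d * (s powr - \<mu>) ^ m"
    using s0 by (simp add: b(1) powr_powr algebra_simps flip: powr_realpow powr_add)
  have pp: "x powr - (\<gamma> * real m) = (x powr - \<gamma>) ^ m" if "0 < x" for x
    using that by (simp add: powr_powr flip: powr_realpow)
  have 1: "0 < 1 - \<phi> * s powr - \<rho>" using sm by simp
  have 2: "0 < 1 + \<phi> * s powr - \<rho>" using \<phi> s0 by (auto intro!: add_pos_nonneg)
  have "inverse (symbol s) = s powr - \<mu> * (1 + \<phi> * s powr - \<rho>) powr - \<gamma>"
    by (simp add: symbol_def powr_minus)
  then show ?thesis
    using has_laplace_mittag_leffler3[OF s0 _ \<rho>(1) b(2) \<phi> sm, of "\<gamma> * real m"] \<gamma>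
    by (simp add: sp pp[OF 1] pp[OF 2] power_mult_distrib mult.assoc)
qed

lemma in_expansion_range_ratio:
  assumes s: "in_expansion_range s"
  shows "0 \<le> lam * (s powr - \<mu> * (1 - \<phi> * s powr - \<rho>) powr - \<gamma>)"
    "lam * (s powr - \<mu> * (1 - \<phi> * s powr - \<rho>) powr - \<gamma>) < 1"
    "0 < lam * inverse (symbol s)" "lam * inverse (symbol s) < 1"
proof -
  have s0: "0 < s" and sm: "\<phi> * s powr - \<rho> < 1" using s by (auto simp: in_expansion_range_def)
  show "0 \<le> lam * (s powr - \<mu> * (1 - \<phi> * s powr - \<rho>) powr - \<gamma>)" using lam by simp
  show 1: "lam * (s powr - \<mu> * (1 - \<phi> * s powr - \<rho>) powr - \<gamma>) < 1"
    using s by (simp add: in_expansion_range_def mult.assoc)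
  show "0 < lam * inverse (symbol s)" using lam symbol_pos[OF s0] by simp
  have "lam * inverse (symbol s) = lam * (s powr - \<mu> * (1 + \<phi> * s powr - \<rho>) powr - \<gamma>)"
    by (simp add: symbol_def powr_minus)
  also have "\<dots> \<le> lam * (s powr - \<mu> * (1 - \<phi> * s powr - \<rho>) powr - \<gamma>)"
  proof (intro mult_left_mono powr_mono2')
    show "1 - \<phi> * s powr - \<rho> \<le> 1 + \<phi> * s powr - \<rho>" using \<phi> by simp
  qed (use lam \<gamma> sm in auto)
  finally show "lam * inverse (symbol s) < 1" using 1 by simp
qed

lemma has_laplace_dens:
  assumes s: "in_expansion_range s"
  shows "\<exists>B. has_laplace s dens B (density_transform s)"
proof -
  have s0: "0 < s" using s by (simp add: in_expansion_range_def)
  define h where "h r t = (lam * (- lam) ^ r) *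
      (t powr (\<mu> * real (Suc r) - 1) * mittag_leffler3 (\<gamma> * real (Suc r)) \<rho> (\<mu> * real (Suc r)) (- \<phi> * t powr \<rho>))"
    for r t
  define y where "y = s powr - \<mu> * (1 - \<phi> * s powr - \<rho>) powr - \<gamma>"
  define z where "z = inverse (symbol s)"
  have y: "0 \<le> lam * y" "lam * y < 1" and z: "0 < lam * z" "lam * z < 1"
    unfolding y_def z_def using in_expansion_range_ratio[OF s] .
  have hr: "has_laplace s (h r) (\<bar>lam * (- lam) ^ r\<bar> * y ^ Suc r) ((lam * (- lam) ^ r) * z ^ Suc r)" for r
  proof -
    have "has_laplace s (h r) (\<bar>lam * (- lam) ^ r\<bar> * (s powr - 0 * y ^ Suc r)) ((lam * (- lam) ^ r) * (s powr - 0 * z ^ Suc r))"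
      unfolding h_def y_def z_def
      by (intro has_laplace_cmult has_laplace_ml_power s) (use \<mu> in auto)
    then show ?thesis using s0 by simp
  qed
  have "(\<lambda>r. lam * y * (lam * y) ^ r) sums (lam * y * (1 / (1 - lam * y)))"
    using y by (intro sums_mult geometric_sums) auto
  moreover have "\<bar>lam * (- lam) ^ r\<bar> * y ^ Suc r = lam * y * (lam * y) ^ r" for r
    using lam by (simp add: abs_mult power_abs power_mult_distrib)
  ultimately have B: "summable (\<lambda>r. \<bar>lam * (- lam) ^ r\<bar> * y ^ Suc r)"
    by (simp only: sums_iff)
  have "(\<lambda>r. lam * z * (- (lam * z)) ^ r) sums (lam * z * (1 / (1 - - (lam * z))))"
    using z by (intro sums_mult geometric_sums) auto
  moreover have "(lam * (- lam) ^ r) * z ^ Suc r = lam * z * (- (lam * z)) ^ r" for r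
    using power_mult_distrib[of "- lam" z r] by simp
  moreover have "lam * z * (1 / (1 - - (lam * z))) = density_transform s"
    using symbol_pos[OF s0] lam by (simp add: density_transform_def z_def field_simps)
  ultimately have L: "(\<Sum>r. (lam * (- lam) ^ r) * z ^ Suc r) = density_transform s" by (simp only: sums_iff)
  have "has_laplace s (\<lambda>t. \<Sum>r. h r t) (\<Sum>r. \<bar>lam * (- lam) ^ r\<bar> * y ^ Suc r) (density_transform s)"
    using has_laplace_suminf[OF hr B s0] by (simp only: L)
  moreover have "dens t = (\<Sum>r. h r t)" if t: "0 < t" for t
  proof -
    have h: "h r t = lam * t powr (\<mu> - 1) * ((- lam * t powr \<mu>) ^ r *
           mittag_leffler3 (\<gamma> * real r + \<gamma>) \<rho> (\<mu> * real r + \<mu>) (- \<phi> * t powr \<rho>))" for r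
    proof -
      have "t powr (\<mu> * real (Suc r) - 1) = t powr (\<mu> - 1) * (t powr \<mu>) ^ r"
        using t by (simp add: powr_powr flip: powr_realpow powr_add) (simp add: algebra_simps)
      then show ?thesis
        unfolding h_def power_mult_distrib by (simp add: distrib_left mult_ac add_ac)
    qed
    have "summable (\<lambda>r. h r t)"
      using has_laplace_summable[OF hr B t] by (rule summable_rabs_cancel)
    then have "summable (\<lambda>r. (- lam * t powr \<mu>) ^ r *
           mittag_leffler3 (\<gamma> * real r + \<gamma>) \<rho> (\<mu> * real r + \<mu>) (- \<phi> * t powr \<rho>))"
      unfolding h using t lam by (subst (asm) summable_cmult_iff) auto
    then show ?thesis
      using t unfolding h waiting_density_def by (simp add: suminf_mult)
  qed
  ultimately show ?thesis
    by (subst has_laplace_cong[where h = "\<lambda>t. \<Sum>r. h r t"]) auto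
qed

text \<open>
  With \<open>u = \<lambda>/\<psi>(s)\<close> the series is \<open>u\<^sup>k / s\<close> times the negative binomial series
  \<open>(1 + u) powr - (k + 1)\<close>, and \<open>u / (1 + u)\<close> is the transform of the density.
\<close>

lemma has_laplace_state:
  assumes s: "in_expansion_range s"
  shows "\<exists>B. has_laplace s (state k) B ((density_transform s ^ k - density_transform s ^ Suc k) / s)"
proof -
  have s0: "0 < s" using s by (simp add: in_expansion_range_def)
  define c where "c i = (- 1) ^ i * real ((k + i) choose k) * lam ^ (k + i)" for i
  define h where "h i t = c i *
      (t powr (\<mu> * real (k + i) + 1 - 1) * mittag_leffler3 (\<gamma> * real (k + i)) \<rho> (\<mu> * real (k + i) + 1) (- \<phi> * t powr \<rho>))"
    for i t
  define y where "y = s powr - \<mu> * (1 - \<phi> * s powr - \<rho>) powr - \<gamma>"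
  define z where "z = inverse (symbol s)"
  have y: "0 \<le> lam * y" "lam * y < 1" and z: "0 < lam * z" "lam * z < 1"
    unfolding y_def z_def using in_expansion_range_ratio[OF s] .
  have hi: "has_laplace s (h i) (\<bar>c i\<bar> * (s powr - 1 * y ^ (k + i))) (c i * (s powr - 1 * z ^ (k + i)))" for i
    unfolding h_def y_def z_def
    by (intro has_laplace_cmult has_laplace_ml_power s) (use \<mu> in \<open>auto intro!: add_nonneg_pos\<close>)
  have choose: "real ((k + i) choose k) = pochhammer (real (Suc k)) i / fact i" for i
  proof -
    have "(k + i) choose k = (k + i) choose i"
      by (subst binomial_symmetric) auto
    then show ?thesis by (simp add: binomial_gbinomial gbinomial_pochhammer' add_ac)
  qed
  have "(\<lambda>i. s powr - 1 * (lam * y) ^ k * (pochhammer (real (Suc k)) i / fact i * (lam * y) ^ i)) sums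
      (s powr - 1 * (lam * y) ^ k * ((1 - lam * y) powr - real (Suc k)))"
    using y by (intro sums_mult binomial_series_neg) auto
  moreover have "\<bar>c i\<bar> * (s powr - 1 * y ^ (k + i)) =
      s powr - 1 * (lam * y) ^ k * (pochhammer (real (Suc k)) i / fact i * (lam * y) ^ i)" for i
    unfolding choose[symmetric] using lam
    by (simp add: c_def abs_mult power_mult_distrib power_add)
  ultimately have B: "summable (\<lambda>i. \<bar>c i\<bar> * (s powr - 1 * y ^ (k + i)))"
    by (simp only: sums_iff)
  have "(\<lambda>i. s powr - 1 * (lam * z) ^ k * (pochhammer (real (Suc k)) i / fact i * (- (lam * z)) ^ i)) sums
      (s powr - 1 * (lam * z) ^ k * ((1 - - (lam * z)) powr - real (Suc k)))"
    using z by (intro sums_mult binomial_series_neg) auto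
  moreover have "c i * (s powr - 1 * z ^ (k + i)) =
      s powr - 1 * (lam * z) ^ k * (pochhammer (real (Suc k)) i / fact i * (- (lam * z)) ^ i)" for i
    unfolding choose[symmetric]
    by (subst power_minus) (simp add: c_def power_mult_distrib power_add)
  moreover have "s powr - 1 * (lam * z) ^ k * ((1 - - (lam * z)) powr - real (Suc k)) = (density_transform s ^ k - density_transform s ^ Suc k) / s"
  proof -
    define u where "u = lam * z"
    have u: "0 < u" using z by (simp add: u_def)
    have density_transform: "density_transform s = u / (1 + u)"
      using symbol_pos[OF s0] lam by (simp add: density_transform_def z_def u_def field_simps)
    have "(1 + u) powr - real (Suc k) = inverse ((1 + u) ^ Suc k)"
      using u by (simp add: powr_minus powr_realpow del: of_nat_Suc)
    moreover have "density_transform s ^ k - density_transform s ^ Suc k = density_transform s ^ k * (1 - density_transform s)" by (simp add: algebra_simps)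
    moreover have "1 - density_transform s = inverse (1 + u)" using u by (simp add: density_transform field_simps)
    ultimately show ?thesis
      using s0 u by (simp add: density_transform u_def[symmetric] powr_minus divide_inverse power_mult_distrib power_inverse mult_ac)
  qed
  ultimately have L: "(\<Sum>i. c i * (s powr - 1 * z ^ (k + i))) = (density_transform s ^ k - density_transform s ^ Suc k) / s"
    by (simp only: sums_iff)
  have "has_laplace s (\<lambda>t. \<Sum>i. h i t) (\<Sum>i. \<bar>c i\<bar> * (s powr - 1 * y ^ (k + i))) ((density_transform s ^ k - density_transform s ^ Suc k) / s)"
    using has_laplace_suminf[OF hi B s0] by (simp only: L)
  moreover have "state k t = (\<Sum>i. h i t)" if t: "0 < t" for t
  proof -
    have "(lam * t powr \<mu>) ^ (k + i) = lam ^ (k + i) * t powr (\<mu> * real (k + i) + 1 - 1)" for i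
      using t by (simp add: powr_powr power_mult_distrib flip: powr_realpow powr_add)
    then show ?thesis
      by (simp add: gfpp_state_prob_def Let_def h_def c_def mult.assoc)
  qed
  ultimately show ?thesis
    by (subst has_laplace_cong[where h = "\<lambda>t. \<Sum>i. h i t"]) auto
qed

lemma state_0: "state k 0 = (if k = 0 then 1 else 0)"
proof (cases "k = 0")
  case True
  have "state k 0 = (\<Sum>i. if i = 0 then 1 else 0 :: real)"
    unfolding gfpp_state_prob_def Let_def
  proof (rule suminf_cong)
    fix i
    have "mittag_leffler3 0 \<rho> 1 0 = (\<Sum>k. if k = 0 then 1 else 0 :: real)"
      unfolding mittag_leffler3_def by (rule suminf_cong) auto
    then have "mittag_leffler3 0 \<rho> 1 0 = 1" using sums_If_finite[of "\<lambda>k. k = 0" "\<lambda>k. 1 :: real"]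
      by (simp add: sums_iff)
    then show "(- 1) ^ i * real (k + i choose k) * (lam * 0 powr \<mu>) ^ (k + i) *
         mittag_leffler3 (\<gamma> * real (k + i)) \<rho> (\<mu> * real (k + i) + 1) (- \<phi> * 0 powr \<rho>) = (if i = 0 then 1 else 0)"
      using True by auto
  qed
  then show ?thesis
    using True sums_If_finite[of "\<lambda>k. k = 0" "\<lambda>k. 1 :: real"] by (simp add: sums_iff)
next
  case False
  then have *: "(lam * 0 powr \<mu>) ^ (k + i) = 0" for i by simp
  show ?thesis using False unfolding gfpp_state_prob_def Let_def * by simp
qed

end

section \<open>Derivatives, positivity and uniqueness for Laplace transforms\<close>

lemma norm_exp_minus_one_le:
  fixes z :: "'a::{real_normed_field, banach}"
  shows "norm (exp z - 1) \<le> norm z * exp (norm z)"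
proof -
  have "norm (exp z - exp 0) \<le> exp (norm z) * norm (z - 0)"
  proof (rule field_differentiable_bound[where S = "cball 0 (norm z)" and f' = exp])
    fix w :: 'a assume "w \<in> cball 0 (norm z)"
    then have "exp (norm w) \<le> exp (norm z)" by simp
    then show "norm (exp w) \<le> exp (norm z)" using norm_exp[of w] by linarith
  qed (auto intro!: derivative_eq_intros)
  then show ?thesis by (simp add: mult.commute)
qed

text \<open>
  The Laplace integral of \<open>g\<close> converges absolutely on the open half-line to the right of \<open>c\<close>. The
  inequality is strict so that the condition passes to \<open>t * g t\<close>.
\<close>

definition exp_integrable :: "real \<Rightarrow> (real \<Rightarrow> real) \<Rightarrow> bool" where
  "exp_integrable c g \<longleftrightarrow> (\<forall>x>c. integrable pos_line (\<lambda>t. exp (- x * t) * g t))"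

lemma exp_integrableD: "exp_integrable c g \<Longrightarrow> c < x \<Longrightarrow> integrable pos_line (\<lambda>t. exp (- x * t) * g t)"
  by (simp add: exp_integrable_def)

lemma exp_integrable_measurable:
  assumes "exp_integrable c g"
  shows "g \<in> borel_measurable pos_line"
proof -
  have "(\<lambda>t. exp (- (c + 1) * t) * g t) \<in> borel_measurable pos_line"
    using exp_integrableD[OF assms, of "c + 1"] by auto
  moreover have "(\<lambda>t. exp ((c + 1) * t)) \<in> borel_measurable pos_line"
    by (intro borel_measurable_pos_line continuous_intros)
  ultimately have "(\<lambda>t. exp ((c + 1) * t) * (exp (- (c + 1) * t) * g t)) \<in> borel_measurable pos_line"
    by (rule borel_measurable_times[rotated])
  moreover have "exp ((c + 1) * t) * (exp (- (c + 1) * t) * g t) = g t" for t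
    by (simp add: mult.assoc[symmetric] flip: exp_add) (simp add: algebra_simps)
  ultimately show ?thesis by (simp only:)
qed

lemma exp_integrable_times:
  assumes "exp_integrable c g"
  shows "exp_integrable c (\<lambda>t. t * g t)"
  unfolding exp_integrable_def
proof (intro allI impI)
  fix x assume x: "c < x"
  \<comment> \<open>Half of the distance to \<open>c\<close> absorbs the factor \<open>t\<close>.\<close>
  define d where "d = (x - c) / 2"
  have d: "0 < d" "c < x - d" using x by (auto simp: d_def field_simps)
  have m: "g \<in> borel_measurable pos_line" using assms by (rule exp_integrable_measurable)
  show "integrable pos_line (\<lambda>t. exp (- x * t) * (t * g t))"
  proof (rule Bochner_Integration.integrable_bound)
    show "integrable pos_line (\<lambda>t. 1 / d * (exp (- (x - d) * t) * g t))"
      using exp_integrableD[OF assms d(2)] by simp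
    show "(\<lambda>t. exp (- x * t) * (t * g t)) \<in> borel_measurable pos_line"
      by (intro borel_measurable_times m borel_measurable_pos_line continuous_intros)
    show "AE t in pos_line. norm (exp (- x * t) * (t * g t)) \<le> norm (1 / d * (exp (- (x - d) * t) * g t))"
    proof (rule AE_I2)
      fix t assume "t \<in> space pos_line"
      then have t: "0 < t" by simp
      have "d * t \<le> exp (d * t)" using exp_ge_add_one_self[of "d * t"] by linarith
      then have "t \<le> exp (d * t) / d" using d by (simp add: field_simps)
      then have "exp (- x * t) * \<bar>g t\<bar> * t \<le> exp (- x * t) * \<bar>g t\<bar> * (exp (d * t) / d)"
        by (intro mult_left_mono) auto
      also have "\<dots> = 1 / d * (exp (- (x - d) * t) * \<bar>g t\<bar>)"
        by (simp add: field_simps flip: exp_add)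
      finally show "norm (exp (- x * t) * (t * g t)) \<le> norm (1 / d * (exp (- (x - d) * t) * g t))"
        using t d by (simp add: abs_mult mult_ac)
    qed
  qed
qed

lemma exp_integrable_power:
  assumes "exp_integrable c g"
  shows "exp_integrable c (\<lambda>t. t ^ n * g t)"
proof (induction n)
  case (Suc n)
  then show ?case using exp_integrable_times[OF Suc] by (simp add: mult.assoc)
qed (use assms in simp)

lemma exp_integrable_uminus:
  "exp_integrable c g \<Longrightarrow> exp_integrable c (\<lambda>t. - g t)"
  by (simp add: exp_integrable_def)

text \<open>
  The hypothesis on \<open>s\<close> is an equality with \<open>x = Re s\<close> over the complex numbers and with \<open>x = s\<close>
  over the reals, so the lemma provides holomorphy as well as the real derivative.
\<close>

lemma DERIV_laplace:
  fixes s :: "'a::{real_normed_field, banach, second_countable_topology}"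
  assumes g: "exp_integrable c g" and x: "c < x"
    and s: "\<And>t. 0 < t \<Longrightarrow> norm (exp (- s * of_real t)) \<le> exp (- x * t)"
  shows "((\<lambda>s. \<integral>t. exp (- s * of_real t) * of_real (g t) \<partial>pos_line) has_field_derivative
    - (\<integral>t. exp (- s * of_real t) * of_real (t * g t) \<partial>pos_line)) (at s)"
  unfolding has_field_derivative_iff tendsto_at_iff_sequentially
proof (intro allI impI)
  fix Y :: "nat \<Rightarrow> 'a" assume Y0: "\<forall>i. Y i \<in> UNIV - {s}" and Y: "Y \<longlonglongrightarrow> s"
  define d where "d = (x - c) / 2"
  have d: "0 < d" "c < x - d" using x by (auto simp: d_def field_simps)
  have m: "g \<in> borel_measurable pos_line" using g by (rule exp_integrable_measurable)
  have em: "(\<lambda>t. exp (- s * of_real t) * of_real (h t) :: 'a) \<in> borel_measurable pos_line"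
    if "h \<in> borel_measurable pos_line" for h :: "real \<Rightarrow> real" and s :: 'a
    by (rule borel_measurable_times[OF borel_measurable_pos_line measurable_compose[OF that borel_measurable_of_real]])
       (intro continuous_intros)
  have gt: "exp_integrable c (\<lambda>t. t * g t)" using g by (rule exp_integrable_times)
  have mt: "(\<lambda>t. t * g t) \<in> borel_measurable pos_line" using gt by (rule exp_integrable_measurable)
  obtain N where N: "\<And>n. N \<le> n \<Longrightarrow> norm (Y n - s) < d"
    using LIMSEQ_D[OF Y d(1)] by auto
  define Z where "Z n = Y (n + N)" for n
  have Zs: "Z n \<noteq> s" for n using Y0 by (auto simp: Z_def)
  have Zd: "norm (Z n - s) \<le> d" for n using N[of "n + N"] by (simp add: Z_def less_imp_le)
  have Z: "Z \<longlonglongrightarrow> s" unfolding Z_def using Y by (rule LIMSEQ_ignore_initial_segment)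
  have nexp: "norm (exp (- z * of_real t)) \<le> exp (- (x - d) * t)" if "norm (z - s) \<le> d" "0 < t" for z t
  proof -
    have "norm (exp (- z * of_real t)) = norm (exp (- s * of_real t)) * norm (exp (- (z - s) * of_real t))"
      by (simp add: algebra_simps flip: norm_mult exp_add)
    also have "\<dots> \<le> exp (- x * t) * exp (d * t)"
    proof (rule mult_mono)
      have "norm (exp (- (z - s) * of_real t)) \<le> exp (norm (- (z - s) * of_real t))" by (rule norm_exp)
      also have "norm (- (z - s) * of_real t) = norm (z - s) * t"
        using that by (simp add: norm_mult norm_minus_commute)
      also have "exp (norm (z - s) * t) \<le> exp (d * t)" using that by simp
      finally show "norm (exp (- (z - s) * of_real t)) \<le> exp (d * t)" .
    qed (use s that in auto)
    finally show ?thesis by (simp add: algebra_simps flip: exp_add)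
  qed
  have int: "integrable pos_line (\<lambda>t. exp (- z * of_real t) * of_real (g t))" if "norm (z - s) \<le> d" for z
  proof (rule Bochner_Integration.integrable_bound[OF exp_integrableD[OF g d(2)] em[OF m]])
    show "AE t in pos_line. norm (exp (- z * of_real t) * of_real (g t)) \<le> norm (exp (- (x - d) * t) * g t)"
      by (rule AE_I2) (use nexp[OF that] in \<open>auto simp: norm_mult abs_mult intro!: mult_right_mono\<close>)
  qed
  have "(\<lambda>n. \<integral>t. (exp (- Z n * of_real t) * of_real (g t) - exp (- s * of_real t) * of_real (g t)) / (Z n - s) \<partial>pos_line)
      \<longlonglongrightarrow> (\<integral>t. - (exp (- s * of_real t) * of_real (t * g t)) \<partial>pos_line)"
  proof (rule integral_dominated_convergence)
    show "(\<lambda>t. - (exp (- s * of_real t) * of_real (t * g t))) \<in> borel_measurable pos_line"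
      using em[OF mt] by simp
    show "(\<lambda>t. (exp (- Z n * of_real t) * of_real (g t) - exp (- s * of_real t) * of_real (g t)) / (Z n - s))
        \<in> borel_measurable pos_line" for n
      by (intro borel_measurable_divide borel_measurable_diff em m borel_measurable_const)
    show "integrable pos_line (\<lambda>t. \<bar>exp (- (x - d) * t) * (t * g t)\<bar>)"
      using exp_integrableD[OF gt d(2)] by (rule integrable_abs)
    show "AE t in pos_line. (\<lambda>n. (exp (- Z n * of_real t) * of_real (g t) - exp (- s * of_real t) * of_real (g t)) / (Z n - s))
        \<longlonglongrightarrow> - (exp (- s * of_real t) * of_real (t * g t))"
    proof (rule AE_I2)
      fix t
      have "((\<lambda>z. exp (- z * of_real t) * of_real (g t)) has_field_derivative
          - (exp (- s * of_real t) * of_real (t * g t))) (at s)"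
        by (auto intro!: derivative_eq_intros)
      then have "((\<lambda>z. (exp (- z * of_real t) * of_real (g t) - exp (- s * of_real t) * of_real (g t)) / (z - s))
          \<longlongrightarrow> - (exp (- s * of_real t) * of_real (t * g t))) (at s)"
        by (simp only: has_field_derivative_iff)
      then show "(\<lambda>n. (exp (- Z n * of_real t) * of_real (g t) - exp (- s * of_real t) * of_real (g t)) / (Z n - s))
        \<longlonglongrightarrow> - (exp (- s * of_real t) * of_real (t * g t))"
        unfolding tendsto_at_iff_sequentially comp_def using Zs Z by blast
    qed
    show "AE t in pos_line. norm ((exp (- Z n * of_real t) * of_real (g t) - exp (- s * of_real t) * of_real (g t)) / (Z n - s))
        \<le> \<bar>exp (- (x - d) * t) * (t * g t)\<bar>" for n
    proof (rule AE_I2)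
      fix t assume "t \<in> space pos_line"
      then have t: "0 < t" by simp
      have pos: "0 < norm (Z n - s)" using Zs by simp
      have "exp (- Z n * of_real t) * of_real (g t) - exp (- s * of_real t) * of_real (g t)
          = exp (- s * of_real t) * of_real (g t) * (exp (- (Z n - s) * of_real t) - 1)"
        by (simp add: algebra_simps flip: exp_add)
      then have "norm (exp (- Z n * of_real t) * of_real (g t) - exp (- s * of_real t) * of_real (g t))
          = norm (exp (- s * of_real t)) * \<bar>g t\<bar> * norm (exp (- (Z n - s) * of_real t) - 1)"
        by (simp only: norm_mult norm_of_real)
      also have "\<dots> \<le> exp (- x * t) * \<bar>g t\<bar> * (norm (Z n - s) * t * exp (d * t))"
      proof (intro mult_mono)
        have "norm (exp (- (Z n - s) * of_real t) - 1) \<le>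
            norm (- (Z n - s) * of_real t) * exp (norm (- (Z n - s) * of_real t))"
          by (rule norm_exp_minus_one_le)
        also have "norm (- (Z n - s) * of_real t) = norm (Z n - s) * t"
          using t by (simp add: norm_mult norm_minus_commute)
        also have "norm (Z n - s) * t * exp (norm (Z n - s) * t) \<le> norm (Z n - s) * t * exp (d * t)"
          using Zd t by (intro mult_left_mono) auto
        finally show "norm (exp (- (Z n - s) * of_real t) - 1) \<le> norm (Z n - s) * t * exp (d * t)" .
      qed (use s[OF t] t in auto)
      also have "\<dots> = norm (Z n - s) * (exp (- (x - d) * t) * (t * \<bar>g t\<bar>))"
        by (simp add: algebra_simps exp_diff exp_add exp_minus divide_inverse)
      finally show "norm ((exp (- Z n * of_real t) * of_real (g t) - exp (- s * of_real t) * of_real (g t)) / (Z n - s))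
        \<le> \<bar>exp (- (x - d) * t) * (t * g t)\<bar>"
        using pos t by (simp add: norm_divide abs_mult field_simps)
    qed
  qed
  moreover have "(\<integral>t. (exp (- Z n * of_real t) * of_real (g t) - exp (- s * of_real t) * of_real (g t)) / (Z n - s) \<partial>pos_line)
      = ((\<integral>t. exp (- Z n * of_real t) * of_real (g t) \<partial>pos_line) -
         (\<integral>t. exp (- s * of_real t) * of_real (g t) \<partial>pos_line)) / (Z n - s)" for n
    using int[OF Zd] int[of s] d by (simp add: Bochner_Integration.integral_diff)
  ultimately have "(\<lambda>n. ((\<integral>t. exp (- Z n * of_real t) * of_real (g t) \<partial>pos_line) -
         (\<integral>t. exp (- s * of_real t) * of_real (g t) \<partial>pos_line)) / (Z n - s))
      \<longlonglongrightarrow> - (\<integral>t. exp (- s * of_real t) * of_real (t * g t) \<partial>pos_line)"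
    by (simp only: Bochner_Integration.integral_minus)
  then show "((\<lambda>y. ((\<integral>t. exp (- y * of_real t) * of_real (g t) \<partial>pos_line) -
         (\<integral>t. exp (- s * of_real t) * of_real (g t) \<partial>pos_line)) / (y - s)) \<circ> Y)
      \<longlonglongrightarrow> - (\<integral>t. exp (- s * of_real t) * of_real (t * g t) \<partial>pos_line)"
    unfolding Z_def comp_def by (rule LIMSEQ_offset)
qed

lemma DERIV_laplace_real:
  fixes x :: real
  assumes "exp_integrable c g" "c < x"
  shows "((\<lambda>x. \<integral>t. exp (- x * t) * g t \<partial>pos_line) has_real_derivative
    - (\<integral>t. exp (- x * t) * (t * g t) \<partial>pos_line)) (at x)"
  using DERIV_laplace[OF assms, of x] by simp

lemma laplace_zero_moments:
  assumes "exp_integrable c g" "\<And>x. c < x \<Longrightarrow> (\<integral>t. exp (- x * t) * g t \<partial>pos_line) = 0" "c < x"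
  shows "(\<integral>t. exp (- x * t) * (t ^ n * g t) \<partial>pos_line) = 0"
  using assms
proof (induction n arbitrary: g x)
  case (Suc n)
  have "(\<integral>t. exp (- x * t) * (t * g t) \<partial>pos_line) = 0" if x: "c < x" for x
  proof -
    have "((\<lambda>x. 0) has_real_derivative - (\<integral>t. exp (- x * t) * (t * g t) \<partial>pos_line)) (at x)"
      by (rule has_field_derivative_transform_within_open[OF DERIV_laplace_real[OF Suc.prems(1) x], where S = "{c<..}"])
         (use Suc.prems(2) x in auto)
    then show ?thesis using DERIV_unique[OF _ DERIV_const] by fastforce
  qed
  from Suc.IH[OF exp_integrable_times[OF Suc.prems(1)] this Suc.prems(3)]
  show ?case by (simp add: mult_ac)
qed simp

text \<open>
  The function \<open>v exp (- v)\<close> increases up to 1 and decreases afterwards; the hypothesis covers both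
  sides at once, \<open>u\<close> lying between 1 and \<open>v\<close>.
\<close>

lemma mult_exp_minus_unimodal:
  fixes u v :: real
  assumes "0 < u" "0 \<le> (v - u) * (u - 1)"
  shows "v * exp (- v) \<le> u * exp (- u)"
proof -
  have "v \<le> u * (1 + (v - u))" using assms by (simp add: algebra_simps)
  also have "\<dots> \<le> u * exp (v - u)"
    using assms exp_ge_add_one_self[of "v - u"] by (intro mult_left_mono) auto
  finally have "v * exp (- v) \<le> u * exp (v - u) * exp (- v)" by (intro mult_right_mono) auto
  also have "\<dots> = u * exp (- u)" by (simp add: mult.assoc flip: exp_add)
  finally show ?thesis .
qed

text \<open>
  Laplace's method. Normalised to have maximum 1 at the midpoint \<open>m\<close> of the interval, the weight
  \<open>t\<^sup>n exp (- n t / m)\<close> is the \<open>n\<close>-th power of a function that stays below some \<open>q < 1\<close> outside the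
  interval and above some \<open>p > q\<close> near \<open>m\<close>. As \<open>(q/p)\<^sup>n\<close> tends to 0, the contribution from the
  interval determines the sign of the integral for large \<open>n\<close>.
\<close>

lemma moments_nonneg_not_negative_on_interval:
  assumes g: "exp_integrable c g"
    and mom: "\<And>x n. c < x \<Longrightarrow> 0 \<le> (\<integral>t. exp (- x * t) * (t ^ n * g t) \<partial>pos_line)"
    and ab: "0 < a" "a < b" and e: "0 < e" and neg: "\<And>t. a < t \<Longrightarrow> t < b \<Longrightarrow> g t \<le> - e"
  shows False
proof -
  define m where "m = (a + b) / 2"
  have m: "a < m" "m < b" "0 < m" using ab by (auto simp: m_def)
  define w where "w t = t / m * exp (1 - t / m)" for t
  have w_exp: "w t = exp 1 * (t / m * exp (- (t / m)))" for t
    by (simp add: w_def exp_diff exp_minus field_simps)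
  have w_less: "w t < 1" if "0 < t" "t \<noteq> m" for t
  proof -
    have "t / m * exp (- (t / m)) \<le> 1 * exp (- 1)" by (rule mult_exp_minus_unimodal) auto
    then have "w t \<le> exp 1 * (1 * exp (- 1))" unfolding w_exp by (intro mult_left_mono) auto
    then have le: "w t \<le> 1" by (simp flip: exp_add)
    have "w t \<noteq> 1"
    proof
      assume "w t = 1"
      then have "ln (w t) = 0" by simp
      moreover have "ln (w t) = ln (t / m) + (1 - t / m)"
        unfolding w_def using that m by (subst ln_mult) auto
      ultimately have "ln (t / m) = t / m - 1" by simp
      then have "t / m = 1" using that m by (intro ln_eq_minus_one) auto
      then show False using that m by simp
    qed
    with le show ?thesis by simp
  qed
  have wm: "w m = 1" using m by (simp add: w_def)
  have w_pos: "0 < w t" if "0 < t" for t using that m by (simp add: w_def)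
  define q where "q = max (w a) (w b)"
  have q: "0 < q" "q < 1" using w_less[of a] w_less[of b] w_pos[of a] m ab by (auto simp: q_def)
  have w_out: "w t \<le> q" if "0 < t" "\<not> (a < t \<and> t < b)" for t
  proof (cases "t \<le> a")
    case True
    have "0 \<le> (t / m - a / m) * (a / m - 1)"
      using True m by (intro mult_nonpos_nonpos) (auto simp: field_simps)
    then have "w t \<le> w a"
      unfolding w_exp using m ab by (intro mult_left_mono mult_exp_minus_unimodal) auto
    then show ?thesis by (simp add: q_def)
  next
    case False
    then have "0 \<le> (t / m - b / m) * (b / m - 1)"
      using that m by (intro mult_nonneg_nonneg) (auto simp: field_simps)
    then have "w t \<le> w b"
      unfolding w_exp using m ab by (intro mult_left_mono mult_exp_minus_unimodal) auto
    then show ?thesis by (simp add: q_def)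
  qed
  define p where "p = (q + 1) / 2"
  have p: "q < p" "p < 1" "0 < p" using q by (auto simp: p_def)
  have "isCont w m" unfolding w_def using m by (intro continuous_intros) auto
  then have "(w \<longlongrightarrow> w m) (nhds m)"
    by (simp only: isCont_def tendsto_at_iff_tendsto_nhds)
  then have "\<forall>\<^sub>F t in nhds m. p < w t"
    using p wm by (intro order_tendstoD(1)[of w "w m"]) auto
  then obtain d0 where d0: "0 < d0" "\<And>t. dist t m < d0 \<Longrightarrow> p < w t"
    by (auto simp: eventually_nhds_metric)
  define d where "d = min d0 ((b - a) / 2)"
  have d: "0 < d" using d0 ab by (auto simp: d_def)
  define J where "J = {m - d<..<m + d}"
  have J: "a < t \<and> t < b \<and> p < w t" if "t \<in> J" for t
    using that d0(2)[of t] by (auto simp: J_def d_def m_def dist_real_def min_def split: if_splits)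
       (auto simp: abs_less_iff field_simps)
  obtain N :: nat where N: "c < real N / m"
  proof -
    obtain N :: nat where "c * m < real N" using reals_Archimedean2 by blast
    then show ?thesis using m that by (simp add: field_simps)
  qed
  \<comment> \<open>The argument \<open>n / m\<close> of the transform puts the maximum of the weight at \<open>m\<close>.\<close>
  have wpow: "w t ^ n * g t = (exp 1 / m) ^ n * (exp (- (real n / m) * t) * (t ^ n * g t))" for n t
    by (simp add: w_exp power_mult_distrib power_divide exp_of_nat_mult[symmetric] mult_ac)
  have xn: "c < real n / m" if "N \<le> n" for n
    using N divide_right_mono[of "real N" "real n" m] that m by simp
  have int: "integrable pos_line (\<lambda>t. w t ^ n * g t)" if "N \<le> n" for n
    unfolding wpow using exp_integrableD[OF exp_integrable_power[OF g] xn[OF that]]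
    by (rule integrable_mult_right)
  have nonneg: "0 \<le> (\<integral>t. w t ^ n * g t \<partial>pos_line)" if "N \<le> n" for n
    unfolding wpow using mom[OF xn[OF that], of n] m by simp
  have Jsub: "J \<subseteq> {0<..}" using J ab by force
  then have Jset: "J \<in> sets pos_line" by (auto simp: sets_restrict_space_iff J_def)
  have Jem: "emeasure pos_line J = ennreal (2 * d)"
    using d Jsub by (subst emeasure_restrict_space) (auto simp: J_def)
  define K where "K = (\<integral>t. \<bar>w t ^ N * g t\<bar> \<partial>pos_line)"
  have ineq: "e * (2 * d) \<le> K / q ^ N * (q / p) ^ n" if n: "N \<le> n" for n
  proof -
    have intJ: "integrable pos_line (\<lambda>t. e * p ^ n * indicator J t)"
      using Jset Jem by (intro integrable_mult_right integrable_real_indicator) auto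
    have intN: "integrable pos_line (\<lambda>t. q ^ (n - N) * \<bar>w t ^ N * g t\<bar>)"
      using int[of N] by (intro integrable_mult_right integrable_abs) auto
    have "0 \<le> (\<integral>t. w t ^ n * g t \<partial>pos_line)" using nonneg[OF n] .
    also have "\<dots> \<le> (\<integral>t. q ^ (n - N) * \<bar>w t ^ N * g t\<bar> - e * p ^ n * indicator J t \<partial>pos_line)"
    proof (rule integral_mono[OF int[OF n] Bochner_Integration.integrable_diff[OF intN intJ]])
      fix t assume "t \<in> space pos_line"
      then have t: "0 < t" by simp
      show "w t ^ n * g t \<le> q ^ (n - N) * \<bar>w t ^ N * g t\<bar> - e * p ^ n * indicator J t"
      proof (cases "a < t \<and> t < b")
        case True
        have "w t ^ n * g t \<le> w t ^ n * (- e)"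
          using neg True w_pos[OF t] by (intro mult_left_mono) auto
        also have "\<dots> \<le> - (e * p ^ n * indicator J t)"
        proof (cases "t \<in> J")
          case tJ: True
          have "p ^ n \<le> w t ^ n" using J[OF tJ] p by (intro power_mono) auto
          then show ?thesis using tJ e by simp
        next
          case False
          then show ?thesis using e w_pos[OF t] by simp
        qed
        also have "\<dots> \<le> q ^ (n - N) * \<bar>w t ^ N * g t\<bar> - e * p ^ n * indicator J t"
          using q by simp
        finally show ?thesis .
      next
        case False
        have "w t ^ n * g t \<le> w t ^ (n - N) * \<bar>w t ^ N * g t\<bar>"
        proof -
          have "w t ^ n * g t = w t ^ (n - N) * (w t ^ N * g t)"
            using n by (simp add: mult.assoc[symmetric] flip: power_add)
          also have "\<dots> \<le> w t ^ (n - N) * \<bar>w t ^ N * g t\<bar>"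
            using w_pos[OF t] by (intro mult_left_mono) auto
          finally show ?thesis .
        qed
        also have "\<dots> \<le> q ^ (n - N) * \<bar>w t ^ N * g t\<bar>"
          using w_out[OF t False] w_pos[OF t] by (intro mult_right_mono power_mono) auto
        finally show ?thesis using False J by (auto simp: indicator_def)
      qed
    qed
    also have "\<dots> = q ^ (n - N) * K - e * p ^ n * (2 * d)"
    proof -
      have "measure pos_line J = 2 * d" using Jem d by (simp add: measure_def)
      moreover have "J \<inter> {0<..} = J" using Jsub by auto
      ultimately show ?thesis
        using intN intJ by (simp add: K_def)
    qed
    finally have "e * (2 * d) * p ^ n \<le> K * q ^ (n - N)" by (simp add: mult_ac)
    moreover have "q ^ (n - N) = q ^ n / q ^ N" using q n by (simp add: power_diff)
    ultimately have "e * (2 * d) * p ^ n \<le> K / q ^ N * q ^ n" by simp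
    moreover have "0 < p ^ n" using p by simp
    ultimately have "e * (2 * d) \<le> K / q ^ N * q ^ n / p ^ n"
      by (subst pos_le_divide_eq) auto
    then show ?thesis by (simp add: power_divide)
  qed
  have "(\<lambda>n. K / q ^ N * (q / p) ^ n) \<longlonglongrightarrow> K / q ^ N * 0"
    using q p by (intro tendsto_mult_left LIMSEQ_realpow_zero) auto
  then have "e * (2 * d) \<le> K / q ^ N * 0"
    by (rule tendsto_lowerbound) (use ineq in \<open>auto simp: eventually_sequentially\<close>)
  then have "e * (2 * d) \<le> 0" by simp
  moreover have "0 < e * (2 * d)" using e d by simp
  ultimately show False by linarith
qed

lemma moments_nonneg_imp_nonneg:
  assumes g: "exp_integrable c g"
    and mom: "\<And>x n. c < x \<Longrightarrow> 0 \<le> (\<integral>t. exp (- x * t) * (t ^ n * g t) \<partial>pos_line)"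
    and t: "0 < t" "isCont g t"
  shows "0 \<le> g t"
proof (rule ccontr)
  assume "\<not> 0 \<le> g t"
  then have neg: "g t < 0" "g t < g t / 2" by auto
  have "\<forall>\<^sub>F u in nhds t. g u < g t / 2"
    using t(2) neg(2) by (intro order_tendstoD(2)[of g "g t"]) (auto simp: isCont_def tendsto_at_iff_tendsto_nhds)
  then obtain d where d: "0 < d" "\<And>u. dist u t < d \<Longrightarrow> g u < g t / 2"
    by (auto simp: eventually_nhds_metric)
  show False
    by (rule moments_nonneg_not_negative_on_interval[OF g mom, of t "t + d" "- g t / 2"])
       (use d(1) t neg d(2)[THEN less_imp_le] in \<open>auto simp: dist_real_def\<close>)
qed

text \<open>
  If the transform vanishes, so do its derivatives; hence \<open>moments_nonneg_imp_nonneg\<close> applies both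
  to \<open>g\<close> and to its negative.
\<close>

lemma laplace_zero_imp_zero:
  assumes g: "exp_integrable c g" "\<And>x. c < x \<Longrightarrow> (\<integral>t. exp (- x * t) * g t \<partial>pos_line) = 0"
    and t: "0 < t" "isCont g t"
  shows "g t = 0"
proof -
  have "0 \<le> g t"
    by (rule moments_nonneg_imp_nonneg[OF g(1) _ t]) (simp only: laplace_zero_moments[OF g] order_refl)
  moreover have "0 \<le> - g t"
  proof (rule moments_nonneg_imp_nonneg[OF exp_integrable_uminus[OF g(1)] _ t(1)])
    show "isCont (\<lambda>t. - g t) t" using t(2) by (rule isCont_minus)
    fix x n assume "c < x"
    then show "0 \<le> (\<integral>t. exp (- x * t) * (t ^ n * - g t) \<partial>pos_line)"
      using laplace_zero_moments[OF g, of x n] by simp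
  qed
  ultimately show ?thesis by simp
qed

section \<open>Complete monotonicity and Bernstein functions\<close>

text \<open>
  Complete monotonicity on \<open>(0,\<infinity>)\<close>, truncated at order \<open>n\<close>: the derivatives up to order \<open>n\<close> exist
  and alternate in sign. The recursion passes to \<open>- F'\<close>, so that closure properties follow by
  induction from the rules for first derivatives alone.
\<close>

primrec alternating :: "nat \<Rightarrow> (real \<Rightarrow> real) \<Rightarrow> bool" where
  "alternating 0 = (\<lambda>F. \<forall>x>0. 0 \<le> F x)"
| "alternating (Suc n) = (\<lambda>F. (\<forall>x>0. 0 \<le> F x) \<and>
     (\<exists>F'. (\<forall>x>0. (F has_real_derivative - F' x) (at x)) \<and> alternating n F'))"

lemma alternating_SucI:
  assumes "\<And>x. 0 < x \<Longrightarrow> 0 \<le> F x" "\<And>x. 0 < x \<Longrightarrow> (F has_real_derivative - F' x) (at x)" "alternating n F'"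
  shows "alternating (Suc n) F"
  using assms by auto

lemma alternating_SucE:
  assumes "alternating (Suc n) F"
  obtains F' where "\<And>x. 0 < x \<Longrightarrow> (F has_real_derivative - F' x) (at x)" "alternating n F'"
  using assms by auto

lemma alternating_nonneg: "alternating n F \<Longrightarrow> 0 < x \<Longrightarrow> 0 \<le> F x"
  by (cases n) auto

lemma alternating_cong:
  assumes "\<And>x. 0 < x \<Longrightarrow> F x = G x" "alternating n F"
  shows "alternating n G"
proof (cases n)
  case 0
  then show ?thesis using assms by simp
next
  case (Suc m)
  from assms(2) obtain F' where F': "\<And>x. 0 < x \<Longrightarrow> (F has_real_derivative - F' x) (at x)" "alternating m F'"
    unfolding Suc by (rule alternating_SucE) blast
  show ?thesis
    unfolding Suc
  proof (rule alternating_SucI[OF _ _ F'(2)])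
    show "0 \<le> G x" if "0 < x" for x using alternating_nonneg[OF assms(2) that] assms(1)[OF that] by simp
    show "(G has_real_derivative - F' x) (at x)" if "0 < x" for x
      by (rule has_field_derivative_transform_within_open[OF F'(1)[OF that], where S = "{0<..}"])
         (use assms(1) that in auto)
  qed
qed

lemma alternating_Suc_imp: "alternating (Suc n) F \<Longrightarrow> alternating n F"
proof (induction n arbitrary: F)
  case (Suc n)
  from Suc.prems obtain F' where F': "\<And>x. 0 < x \<Longrightarrow> (F has_real_derivative - F' x) (at x)" "alternating (Suc n) F'"
    by (rule alternating_SucE) blast
  show ?case
    by (rule alternating_SucI[OF _ F'(1) Suc.IH[OF F'(2)]]) (use alternating_nonneg[OF Suc.prems] in auto)
qed simp

lemma alternating_add: "alternating n F \<Longrightarrow> alternating n G \<Longrightarrow> alternating n (\<lambda>x. F x + G x)"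
proof (induction n arbitrary: F G)
  case (Suc n)
  from Suc.prems(1) obtain F' where F': "\<And>x. 0 < x \<Longrightarrow> (F has_real_derivative - F' x) (at x)" "alternating n F'"
    by (rule alternating_SucE) blast
  from Suc.prems(2) obtain G' where G': "\<And>x. 0 < x \<Longrightarrow> (G has_real_derivative - G' x) (at x)" "alternating n G'"
    by (rule alternating_SucE) blast
  show ?case
  proof (rule alternating_SucI[OF _ _ Suc.IH[OF F'(2) G'(2)]])
    show "0 \<le> F x + G x" if "0 < x" for x
      using alternating_nonneg[OF Suc.prems(1) that] alternating_nonneg[OF Suc.prems(2) that] by simp
    show "((\<lambda>x. F x + G x) has_real_derivative - (F' x + G' x)) (at x)" if "0 < x" for x
      using DERIV_add[OF F'(1)[OF that] G'(1)[OF that]] by simp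
  qed
qed auto

lemma alternating_mult: "alternating n F \<Longrightarrow> alternating n G \<Longrightarrow> alternating n (\<lambda>x. F x * G x)"
proof (induction n arbitrary: F G)
  case (Suc n)
  from Suc.prems(1) obtain F' where F': "\<And>x. 0 < x \<Longrightarrow> (F has_real_derivative - F' x) (at x)" "alternating n F'"
    by (rule alternating_SucE) blast
  from Suc.prems(2) obtain G' where G': "\<And>x. 0 < x \<Longrightarrow> (G has_real_derivative - G' x) (at x)" "alternating n G'"
    by (rule alternating_SucE) blast
  have "alternating n (\<lambda>x. F' x * G x + F x * G' x)"
    by (rule alternating_add[OF Suc.IH[OF F'(2) alternating_Suc_imp[OF Suc.prems(2)]] Suc.IH[OF alternating_Suc_imp[OF Suc.prems(1)] G'(2)]])
  then show ?case
  proof (rule alternating_SucI[rotated 2])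
    show "0 \<le> F x * G x" if "0 < x" for x
      using alternating_nonneg[OF Suc.prems(1) that] alternating_nonneg[OF Suc.prems(2) that] by simp
    show "((\<lambda>x. F x * G x) has_real_derivative - (F' x * G x + F x * G' x)) (at x)" if "0 < x" for x
      using DERIV_mult[OF F'(1)[OF that] G'(1)[OF that]] by (simp add: algebra_simps)
  qed
qed auto

lemma alternating_const: "0 \<le> c \<Longrightarrow> alternating n (\<lambda>x. c)"
proof (induction n arbitrary: c)
  case (Suc n)
  have "alternating n (\<lambda>x. 0)" by (rule Suc.IH) simp
  then show ?case by (rule alternating_SucI[rotated 2]) (use Suc.prems in auto)
qed auto

lemma alternating_cmult: "0 \<le> c \<Longrightarrow> alternating n F \<Longrightarrow> alternating n (\<lambda>x. c * F x)"
  by (intro alternating_mult alternating_const)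

lemma alternating_sum:
  assumes "\<And>i. i \<in> A \<Longrightarrow> alternating n (F i)"
  shows "alternating n (\<lambda>x. \<Sum>i\<in>A. F i x)"
  using assms by (induction A rule: infinite_finite_induct) (auto intro: alternating_const alternating_add)

lemma alternating_powr: "0 \<le> a \<Longrightarrow> alternating n (\<lambda>x. x powr - a)"
proof (induction n arbitrary: a)
  case (Suc n)
  have "alternating n (\<lambda>x. a * x powr - (a + 1))"
    by (rule alternating_cmult[OF Suc.prems Suc.IH]) (use Suc.prems in simp)
  then show ?case
  proof (rule alternating_SucI[rotated 2])
    show "((\<lambda>x. x powr - a) has_real_derivative - (a * x powr - (a + 1))) (at x)" if "0 < x" for x
    proof -
      have "((\<lambda>x. x powr - a) has_real_derivative - a * x powr (- a - 1)) (at x)"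
        using that by (intro has_real_derivative_powr)
      moreover have "- (a + 1) = - a - 1" by simp
      ultimately show ?thesis by (simp only: mult_minus_left)
    qed
  qed simp
qed auto

text \<open>
  The derivative of \<open>G \<circ> h\<close> is, up to sign, the product of \<open>G' \<circ> h\<close>, to which the induction
  hypothesis applies, and \<open>h'\<close>.
\<close>

lemma alternating_compose:
  assumes "alternating n G" "\<And>x. 0 < x \<Longrightarrow> 0 < h x" "\<And>x. 0 < x \<Longrightarrow> (h has_real_derivative h' x) (at x)" "alternating n h'"
  shows "alternating n (\<lambda>x. G (h x))"
  using assms
proof (induction n arbitrary: G)
  case (Suc n)
  from Suc.prems(1) obtain G' where G': "\<And>x. 0 < x \<Longrightarrow> (G has_real_derivative - G' x) (at x)" "alternating n G'"
    by (rule alternating_SucE) blast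
  have "alternating n (\<lambda>x. G' (h x) * h' x)"
    by (rule alternating_mult[OF Suc.IH[OF G'(2) Suc.prems(2,3)]]) (auto intro!: alternating_Suc_imp[OF Suc.prems(4)])
  then show ?case
  proof (rule alternating_SucI[rotated 2])
    show "0 \<le> G (h x)" if "0 < x" for x
      using alternating_nonneg[OF Suc.prems(1)] Suc.prems(2)[OF that] by blast
    show "((\<lambda>x. G (h x)) has_real_derivative - (G' (h x) * h' x)) (at x)" if "0 < x" for x
      using DERIV_chain2[OF G'(1)[OF Suc.prems(2)[OF that]] Suc.prems(3)[OF that]] by simp
  qed
next
  case 0
  then show ?case using "0"(1,2) by simp
qed

definition bernstein :: "(real \<Rightarrow> real) \<Rightarrow> bool" where
  "bernstein h \<longleftrightarrow> (\<forall>x>0. 0 < h x) \<and>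
     (\<exists>h'. (\<forall>x>0. (h has_real_derivative h' x) (at x)) \<and> (\<forall>n. alternating n h'))"

lemma alternating_compose_bernstein:
  assumes "\<And>n. alternating n G" "bernstein h"
  shows "alternating n (\<lambda>x. G (h x))"
  using assms unfolding bernstein_def by (blast intro: alternating_compose)

lemma bernstein_cong:
  assumes "bernstein h" "\<And>x. 0 < x \<Longrightarrow> h x = k x"
  shows "bernstein k"
proof -
  from assms(1) obtain h' where h': "\<And>x. 0 < x \<Longrightarrow> (h has_real_derivative h' x) (at x)" "\<And>n. alternating n h'"
    by (auto simp: bernstein_def)
  have "(k has_real_derivative h' x) (at x)" if "0 < x" for x
    by (rule has_field_derivative_transform_within_open[OF h'(1)[OF that], where S = "{0<..}"])
       (use assms(2) that in auto)
  then show ?thesis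
    using assms h'(2) by (auto simp: bernstein_def)
qed

lemma bernstein_powr_sum:
  assumes A: "finite A" "A \<noteq> {}" and c: "\<And>i. i \<in> A \<Longrightarrow> 0 < c i"
    and a: "\<And>i. i \<in> A \<Longrightarrow> 0 < a i \<and> a i < 1"
  shows "bernstein (\<lambda>x. \<Sum>i\<in>A. c i * x powr a i)"
  unfolding bernstein_def
proof (intro conjI exI allI impI)
  fix x :: real assume x: "0 < x"
  show "0 < (\<Sum>i\<in>A. c i * x powr a i)"
    using A c x by (intro sum_pos) auto
  show "((\<lambda>x. \<Sum>i\<in>A. c i * x powr a i) has_real_derivative (\<Sum>i\<in>A. c i * a i * x powr - (1 - a i))) (at x)"
  proof (rule DERIV_sum)
    fix i
    show "((\<lambda>x. c i * x powr a i) has_real_derivative c i * a i * x powr - (1 - a i)) (at x)"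
      using x by (auto intro!: derivative_eq_intros)
  qed
next
  fix n
  show "alternating n (\<lambda>x. \<Sum>i\<in>A. c i * a i * x powr - (1 - a i))"
    using a c by (intro alternating_sum alternating_cmult alternating_powr) (auto simp: less_imp_le)
qed

text \<open>
  The derivative is \<open>b h powr - (1 - b)\<close> times that of \<open>h\<close>, and its first factor is completely
  monotone as a negative power composed with a Bernstein function. This needs \<open>b \<le> 1\<close>.
\<close>

lemma bernstein_powr:
  assumes h: "bernstein h" and b: "0 < b" "b \<le> 1"
  shows "bernstein (\<lambda>x. h x powr b)"
proof -
  from h obtain h' where h': "\<And>x. 0 < x \<Longrightarrow> 0 < h x" "\<And>x. 0 < x \<Longrightarrow> (h has_real_derivative h' x) (at x)" "\<And>n. alternating n h'"
    by (auto simp: bernstein_def)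
  have "((\<lambda>x. h x powr b) has_real_derivative b * (h x powr - (1 - b) * h' x)) (at x)" if "0 < x" for x
    using h'(1,2)[OF that] by (auto intro!: derivative_eq_intros)
  moreover have "alternating n (\<lambda>x. b * (h x powr - (1 - b) * h' x))" for n
  proof (intro alternating_cmult alternating_mult h'(3))
    show "alternating n (\<lambda>x. h x powr - (1 - b))"
      by (rule alternating_compose_bernstein[OF alternating_powr h, of "1 - b"]) (use b in simp)
  qed (use b in simp)
  ultimately show ?thesis
    unfolding bernstein_def
    by (intro conjI exI[of _ "\<lambda>x. b * (h x powr - (1 - b) * h' x)"]) (auto dest: h'(1))
qed

lemma bernstein_add_const:
  assumes h: "bernstein h" and c: "0 \<le> c"
  shows "bernstein (\<lambda>x. h x + c)"
proof -
  from h obtain h' where h': "\<And>x. 0 < x \<Longrightarrow> 0 < h x" "\<And>x. 0 < x \<Longrightarrow> (h has_real_derivative h' x) (at x)" "\<And>n. alternating n h'"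
    by (auto simp: bernstein_def)
  have "((\<lambda>x. h x + c) has_real_derivative h' x) (at x)" if "0 < x" for x
    using DERIV_add[OF h'(2)[OF that] DERIV_const] by simp
  then show ?thesis
    unfolding bernstein_def
    by (intro conjI exI[of _ h']) (auto intro: h' add_pos_nonneg c)
qed

lemma alternating_laplace_derivative:
  assumes g: "exp_integrable c g" and c: "0 < c"
    and G: "\<And>x. c < x \<Longrightarrow> (\<integral>t. exp (- x * t) * g t \<partial>pos_line) = G x"
    and G': "\<And>x. 0 < x \<Longrightarrow> (G has_real_derivative - G' x) (at x)" and x: "c < x"
  shows "(\<integral>t. exp (- x * t) * (t * g t) \<partial>pos_line) = G' x"
proof -
  have "(G has_real_derivative - (\<integral>t. exp (- x * t) * (t * g t) \<partial>pos_line)) (at x)"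
    by (rule has_field_derivative_transform_within_open[OF DERIV_laplace_real[OF g x], where S = "{c<..}"])
       (use G x in auto)
  from DERIV_unique[OF this G'] show ?thesis using c x by simp
qed

lemma alternating_laplace_moments_nonneg:
  assumes "exp_integrable c g" "0 < c" "\<And>x. c < x \<Longrightarrow> (\<integral>t. exp (- x * t) * g t \<partial>pos_line) = G x"
    "alternating n G" "c < x"
  shows "0 \<le> (\<integral>t. exp (- x * t) * (t ^ n * g t) \<partial>pos_line)"
  using assms
proof (induction n arbitrary: g G)
  case 0
  then show ?case by simp
next
  case (Suc n)
  from Suc.prems(4) obtain G' where G': "\<And>x. 0 < x \<Longrightarrow> (G has_real_derivative - G' x) (at x)" "alternating n G'"
    by (rule alternating_SucE) blast
  have "0 \<le> (\<integral>t. exp (- x * t) * (t ^ n * (t * g t)) \<partial>pos_line)"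
    by (rule Suc.IH[OF exp_integrable_times[OF Suc.prems(1)] Suc.prems(2) _ G'(2) Suc.prems(5)])
       (rule alternating_laplace_derivative[OF Suc.prems(1-3) G'(1)])
  then show ?case by (simp add: mult_ac)
qed

text \<open>
  The left-hand side is the Taylor polynomial of \<open>G\<close> at \<open>x0\<close>. To the left of \<open>x0\<close> all its terms
  are nonnegative, and so is the remainder, because the difference of \<open>G\<close> and the polynomial is
  nonincreasing and vanishes at \<open>x0\<close>.
\<close>

lemma alternating_laplace_taylor:
  assumes "exp_integrable c g" "0 < c" "\<And>x. c < x \<Longrightarrow> (\<integral>t. exp (- x * t) * g t \<partial>pos_line) = G x"
    "alternating n G" "c < x0" "0 < x" "x \<le> x0"
  shows "(\<Sum>j<n. (x0 - x) ^ j / fact j * (\<integral>t. exp (- x0 * t) * (t ^ j * g t) \<partial>pos_line)) \<le> G x"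
  using assms
proof (induction n arbitrary: g G x)
  case 0
  then show ?case using alternating_nonneg by simp
next
  case (Suc n)
  from Suc.prems(4) obtain G' where G': "\<And>x. 0 < x \<Longrightarrow> (G has_real_derivative - G' x) (at x)" "alternating n G'"
    by (rule alternating_SucE) blast
  define m where "m j = (\<integral>t. exp (- x0 * t) * (t ^ j * g t) \<partial>pos_line)" for j
  have m_Suc: "(\<integral>t. exp (- x0 * t) * (t ^ j * (t * g t)) \<partial>pos_line) = m (Suc j)" for j
    unfolding m_def by (simp add: mult_ac)
  have IH: "(\<Sum>j<n. (x0 - u) ^ j / fact j * m (Suc j)) \<le> G' u" if "0 < u" "u \<le> x0" for u
    using Suc.IH[OF exp_integrable_times[OF Suc.prems(1)] Suc.prems(2) _ G'(2) Suc.prems(5) that]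
      alternating_laplace_derivative[OF Suc.prems(1-3) G'(1)] unfolding m_Suc by blast
  \<comment> \<open>The derivative of \<open>D\<close> is the error of the Taylor polynomial of \<open>G'\<close>, up to sign.\<close>
  define D where "D u = G u - (m 0 + (\<Sum>j<n. (x0 - u) ^ Suc j / fact (Suc j) * m (Suc j)))" for u
  have "D x0 \<le> D x"
  proof (rule DERIV_nonpos_imp_nonincreasing[OF Suc.prems(7)])
    fix u assume u: "x \<le> u" "u \<le> x0"
    then have u0: "0 < u" using Suc.prems(6) by simp
    have "((\<lambda>u. (x0 - u) ^ Suc j / fact (Suc j) * m (Suc j)) has_real_derivative
        - ((x0 - u) ^ j / fact j * m (Suc j))) (at u)" for j
    proof -
      have "((\<lambda>u. (x0 - u) ^ Suc j) has_real_derivative - (real (Suc j) * (x0 - u) ^ j)) (at u)"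
        by (auto intro!: derivative_eq_intros simp del: power_Suc)
      from DERIV_cmult_right[OF DERIV_cdivide[OF this, of "fact (Suc j)"], of "m (Suc j)"]
      show ?thesis by (simp add: field_simps del: power_Suc of_nat_Suc)
    qed
    then have "(D has_real_derivative - G' u - (0 + (\<Sum>j<n. - ((x0 - u) ^ j / fact j * m (Suc j))))) (at u)"
      unfolding D_def using G'(1)[OF u0] by (intro DERIV_diff DERIV_add DERIV_sum DERIV_const) auto
    moreover have "- G' u - (0 + (\<Sum>j<n. - ((x0 - u) ^ j / fact j * m (Suc j)))) \<le> 0"
      using IH[OF u0 u(2)] by (simp add: sum_negf)
    ultimately show "\<exists>y. (D has_real_derivative y) (at u) \<and> y \<le> 0" by blast
  qed
  moreover have "D x0 = 0"
    using Suc.prems(3)[OF Suc.prems(5)] by (simp add: D_def m_def)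
  ultimately show ?case
    unfolding D_def m_def[symmetric] sum.lessThan_Suc_shift by simp
qed

text \<open>
  Expanding \<open>exp ((x0 - x) * t)\<close> turns the integral at \<open>x\<close> into the series whose partial sums
  \<open>alternating_laplace_taylor\<close> bounds by \<open>G x\<close>. As \<open>g\<close> is nonnegative, boundedness of these sums is
  enough for integrability.
\<close>

lemma alternating_laplace_extend:
  assumes g: "exp_integrable c g" and c: "0 < c"
    and G: "\<And>x. c < x \<Longrightarrow> (\<integral>t. exp (- x * t) * g t \<partial>pos_line) = G x"
    and alternating: "\<And>n. alternating n G" and nonneg: "\<And>t. 0 < t \<Longrightarrow> 0 \<le> g t" and x: "0 < x"
  shows "integrable pos_line (\<lambda>t. exp (- x * t) * g t)"
proof -
  define x0 where "x0 = max x (c + 1)"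
  have x0: "c < x0" "x \<le> x0" by (auto simp: x0_def)
  define h where "h j t = (x0 - x) ^ j / fact j * (exp (- x0 * t) * (t ^ j * g t))" for j t
  have h_eq: "h j t = exp (- x0 * t) * g t * (((x0 - x) * t) ^ j / fact j)" for j t
    by (simp add: h_def power_mult_distrib)
  have h0: "norm (h j t) = h j t" if "0 < t" for j t
    using nonneg[OF that] that x0 by (simp add: h_def)
  have sums: "(\<lambda>j. h j t) sums (exp (- x * t) * g t)" for t
  proof -
    have "(\<lambda>j. exp (- x0 * t) * g t * (((x0 - x) * t) ^ j / fact j)) sums (exp (- x0 * t) * g t * exp ((x0 - x) * t))"
      using exp_converges[of "(x0 - x) * t"] by (intro sums_mult) (simp add: divide_inverse mult.commute)
    moreover have "exp (- x0 * t) * g t * exp ((x0 - x) * t) = exp (- x * t) * g t"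
      by (simp add: algebra_simps flip: exp_add)
    ultimately show ?thesis by (simp only: h_eq)
  qed
  have int: "integrable pos_line (h j)" for j
    unfolding h_def using exp_integrableD[OF exp_integrable_power[OF g] x0(1)]
    by (rule integrable_mult_right)
  have ih: "(\<integral>t. h j t \<partial>pos_line) = (x0 - x) ^ j / fact j * (\<integral>t. exp (- x0 * t) * (t ^ j * g t) \<partial>pos_line)" for j
    unfolding h_def by (rule integral_mult_right_zero)
  have nh: "(\<integral>t. norm (h j t) \<partial>pos_line) = (\<integral>t. h j t \<partial>pos_line)" for j
    using h0 by (intro Bochner_Integration.integral_cong) auto
  have part: "(\<Sum>j<n. \<integral>t. h j t \<partial>pos_line) \<le> G x" for n
    unfolding ih using alternating_laplace_taylor[OF g c G alternating x0(1) x x0(2)] .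
  have smi: "summable (\<lambda>j. \<integral>t. norm (h j t) \<partial>pos_line)"
    unfolding nh
  proof (rule summableI_nonneg_bounded)
    show "0 \<le> (\<integral>t. h j t \<partial>pos_line)" for j
      unfolding nh[symmetric] by simp
  qed (rule part)
  have ae: "AE t in pos_line. summable (\<lambda>j. norm (h j t))"
  proof (rule AE_I2)
    fix t assume "t \<in> space pos_line"
    then have "(\<lambda>j. norm (h j t)) = (\<lambda>j. h j t)" using h0 by auto
    then show "summable (\<lambda>j. norm (h j t))"
      using sums_summable[OF sums[of t]] by (simp only:)
  qed
  have eq: "(\<lambda>t. \<Sum>j. h j t) = (\<lambda>t. exp (- x * t) * g t)"
    by (intro ext sums_unique[OF sums, symmetric])
  show "integrable pos_line (\<lambda>t. exp (- x * t) * g t)"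
    using integrable_suminf[OF int ae smi] unfolding eq .
qed

section \<open>The waiting-time density is a probability density\<close>

context gfpp_params
begin

text \<open>
  For \<open>\<gamma> > 0\<close> and \<open>n = \<lceil>\<gamma>\<rceil>\<close>, expanding the \<open>n\<close>-th power in
  \<open>\<psi>(s) = (s powr (\<mu> n / \<gamma>) * (1 + \<phi> s powr - \<rho>)\<^sup>n) powr (\<gamma> / n)\<close>
  produces exactly the exponents \<open>\<mu> n / \<gamma> - r \<rho>\<close> that the hypothesis places in \<open>(0,1)\<close>.
\<close>

lemma symbol_representation:
  obtains n :: nat and c a :: "nat \<Rightarrow> real" and b :: real where
    "0 < b" "b \<le> 1" "\<And>i. i \<le> n \<Longrightarrow> 0 < c i" "\<And>i. i \<le> n \<Longrightarrow> 0 < a i \<and> a i < 1"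
    "\<And>s. 0 < s \<Longrightarrow> symbol s = (\<Sum>i\<le>n. c i * s powr a i) powr b"
proof (cases "\<gamma> = 0")
  case True
  show ?thesis
  proof (rule that[of 1 0 "\<lambda>_. 1" "\<lambda>_. \<mu>"])
    show "symbol s = (\<Sum>i\<le>0::nat. 1 * s powr \<mu>) powr 1" if "0 < s" for s
    proof -
      have "0 < 1 + \<phi> * s powr - \<rho>" using \<phi> by (auto intro!: add_pos_nonneg)
      then show ?thesis unfolding symbol_def using that True by simp
    qed
  qed (use \<mu> in auto)
next
  case False
  then have \<gamma>0: "0 < \<gamma>" using \<gamma> by simp
  define n where "n = nat \<lceil>\<gamma>\<rceil>"
  have n: "of_int \<lceil>\<gamma>\<rceil> = real n" "\<gamma> \<le> real n" "0 < real n"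
    using \<gamma>0 by (auto simp: n_def)
  show ?thesis
  proof (rule that[of "\<gamma> / real n" n "\<lambda>r. real (n choose r) * \<phi> ^ r" "\<lambda>r. \<mu> * real n / \<gamma> - real r * \<rho>"])
    show "0 < \<gamma> / real n" "\<gamma> / real n \<le> 1" using \<gamma>0 n by auto
    show "0 < real (n choose i) * \<phi> ^ i" if "i \<le> n" for i
      using that \<phi> by simp
    show "0 < \<mu> * real n / \<gamma> - real i * \<rho> \<and> \<mu> * real n / \<gamma> - real i * \<rho> < 1" if "i \<le> n" for i
    proof -
      have "int i \<le> \<lceil>\<gamma>\<rceil>" using that n(1) by linarith
      then show ?thesis using exponents False by (simp add: n(1))
    qed
    show "symbol s = (\<Sum>i\<le>n. real (n choose i) * \<phi> ^ i * s powr (\<mu> * real n / \<gamma> - real i * \<rho>)) powr (\<gamma> / real n)"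
      if s: "0 < s" for s
    proof -
      have pos: "0 < 1 + \<phi> * s powr - \<rho>" using \<phi> by (auto intro!: add_pos_nonneg)
      have "(\<Sum>i\<le>n. real (n choose i) * \<phi> ^ i * s powr (\<mu> * real n / \<gamma> - real i * \<rho>))
          = s powr (\<mu> * real n / \<gamma>) * (\<Sum>i\<le>n. real (n choose i) * (\<phi> * s powr - \<rho>) ^ i * 1 ^ (n - i))"
        unfolding sum_distrib_left
      proof (rule sum.cong[OF refl])
        fix i
        have "s powr (\<mu> * real n / \<gamma> - real i * \<rho>) = s powr (\<mu> * real n / \<gamma>) * (s powr - \<rho>) ^ i"
          using s by (simp add: powr_powr mult.commute flip: powr_realpow powr_add)
        then show "real (n choose i) * \<phi> ^ i * s powr (\<mu> * real n / \<gamma> - real i * \<rho>)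
            = s powr (\<mu> * real n / \<gamma>) * (real (n choose i) * (\<phi> * s powr - \<rho>) ^ i * 1 ^ (n - i))"
          by (simp add: power_mult_distrib)
      qed
      also have "\<dots> = s powr (\<mu> * real n / \<gamma>) * (1 + \<phi> * s powr - \<rho>) ^ n"
        by (subst binomial_ring[symmetric]) (simp add: add.commute)
      also have "\<dots> powr (\<gamma> / real n) = symbol s"
        using s \<gamma>0 n pos by (simp add: powr_mult powr_powr symbol_def flip: powr_realpow)
      finally show ?thesis by simp
    qed
  qed
qed

lemma bernstein_symbol: "bernstein symbol"
proof -
  obtain n :: nat and c a :: "nat \<Rightarrow> real" and b :: real where
    *: "0 < b" "b \<le> 1" "\<And>i. i \<le> n \<Longrightarrow> 0 < c i" "\<And>i. i \<le> n \<Longrightarrow> 0 < a i \<and> a i < 1"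
    "\<And>s. 0 < s \<Longrightarrow> symbol s = (\<Sum>i\<le>n. c i * s powr a i) powr b"
    by (rule symbol_representation) blast
  have "bernstein (\<lambda>s. (\<Sum>i\<le>n. c i * s powr a i) powr b)"
    using * by (intro bernstein_powr bernstein_powr_sum) auto
  then show ?thesis by (rule bernstein_cong) (simp add: *(5))
qed

lemma alternating_density_transform: "alternating n density_transform"
proof -
  have *: "alternating n (\<lambda>s. lam * (symbol s + lam) powr - 1)"
    using lam by (intro alternating_cmult alternating_compose_bernstein[OF alternating_powr bernstein_add_const[OF bernstein_symbol], of 1 lam n])
      auto
  have "lam * (symbol s + lam) powr - 1 = density_transform s" if "0 < s" for s
    using add_pos_pos[OF symbol_pos[OF that] lam] unfolding density_transform_def by (simp add: powr_neg_one)
  from alternating_cong[OF this *] show ?thesis by assumption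
qed

lemma symbol_tendsto_0: "(symbol \<longlongrightarrow> 0) (at_right 0)"
proof -
  obtain n :: nat and c a :: "nat \<Rightarrow> real" and b :: real where
    *: "0 < b" "b \<le> 1" "\<And>i. i \<le> n \<Longrightarrow> 0 < c i" "\<And>i. i \<le> n \<Longrightarrow> 0 < a i \<and> a i < 1"
    "\<And>s. 0 < s \<Longrightarrow> symbol s = (\<Sum>i\<le>n. c i * s powr a i) powr b"
    by (rule symbol_representation) blast
  have "((\<lambda>s. c i * s powr a i) \<longlongrightarrow> c i * 0) (at_right 0)" if "i \<le> n" for i
    using *(4)[OF that]
    by (intro tendsto_mult_left tendsto_zero_powrI[where b = "a i"] tendsto_ident_at tendsto_const)
       (auto simp: eventually_at_filter)
  then have "((\<lambda>s. \<Sum>i\<le>n. c i * s powr a i) \<longlongrightarrow> (\<Sum>i\<le>n. c i * 0)) (at_right 0)"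
    by (intro tendsto_sum) auto
  then have "((\<lambda>s. \<Sum>i\<le>n. c i * s powr a i) \<longlongrightarrow> 0) (at_right 0)" by simp
  then have "((\<lambda>s. (\<Sum>i\<le>n. c i * s powr a i) powr b) \<longlongrightarrow> 0) (at_right 0)"
    by (rule tendsto_zero_powrI[where b = b])
       (use *(1,3) in \<open>auto simp: less_imp_le intro!: always_eventually sum_nonneg\<close>)
  moreover have "\<forall>\<^sub>F s in at_right 0. (\<Sum>i\<le>n. c i * s powr a i) powr b = symbol s"
    by (auto simp: eventually_at_filter *(5))
  ultimately show ?thesis by (rule Lim_transform_eventually)
qed

lemma laplace_dens_in_expansion_range:
  obtains c where "0 < c" "exp_integrable c dens" "\<And>x. c < x \<Longrightarrow> (\<integral>t. exp (- x * t) * dens t \<partial>pos_line) = density_transform x"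
proof -
  obtain c where c: "c > 0" "\<And>s. s > c \<Longrightarrow> in_expansion_range s" using eventually_in_expansion_range by blast
  then show ?thesis
    using has_laplace_dens by (intro that[of c]) (auto simp: exp_integrable_def has_laplace_def)
qed

lemma isCont_dens: "0 < t \<Longrightarrow> isCont dens t"
proof -
  assume t: "0 < t"
  obtain c where c: "c > 0" "\<And>s. s > c \<Longrightarrow> in_expansion_range s" using eventually_in_expansion_range by blast
  obtain B where "has_laplace (c + 1) dens B (density_transform (c + 1))" using has_laplace_dens[OF c(2)[of "c + 1"]] by auto
  then have "continuous_on {0<..} dens" by (simp add: has_laplace_def)
  then show "isCont dens t" using t by (simp add: continuous_on_eq_continuous_at)
qed

lemma isCont_state: "0 < t \<Longrightarrow> isCont (state k) t"
proof -
  assume t: "0 < t"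
  obtain c where c: "c > 0" "\<And>s. s > c \<Longrightarrow> in_expansion_range s" using eventually_in_expansion_range by blast
  obtain B where "has_laplace (c + 1) (state k) B ((density_transform (c + 1) ^ k - density_transform (c + 1) ^ Suc k) / (c + 1))"
    using has_laplace_state[OF c(2)[of "c + 1"]] by auto
  then have "continuous_on {0<..} (state k)" by (simp add: has_laplace_def)
  then show "isCont (state k) t" using t by (simp add: continuous_on_eq_continuous_at)
qed

lemma dens_eq_0: "t \<le> 0 \<Longrightarrow> dens t = 0"
  by (auto simp: waiting_density_def)

lemma dens_nonneg: "0 \<le> dens t"
proof (cases "0 < t")
  case True
  obtain c where c: "0 < c" "exp_integrable c dens" "\<And>x. c < x \<Longrightarrow> (\<integral>t. exp (- x * t) * dens t \<partial>pos_line) = density_transform x"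
    by (rule laplace_dens_in_expansion_range) blast
  show ?thesis
    by (rule moments_nonneg_imp_nonneg[OF c(2) alternating_laplace_moments_nonneg[OF c(2,1,3) alternating_density_transform] True isCont_dens[OF True]])
qed (simp add: dens_eq_0)

lemma exp_integrable_dens: "exp_integrable 0 dens"
proof -
  obtain c where c: "0 < c" "exp_integrable c dens" "\<And>x. c < x \<Longrightarrow> (\<integral>t. exp (- x * t) * dens t \<partial>pos_line) = density_transform x"
    by (rule laplace_dens_in_expansion_range) blast
  show "exp_integrable 0 dens"
    unfolding exp_integrable_def
    by (intro allI impI) (rule alternating_laplace_extend[OF c(2,1,3) alternating_density_transform dens_nonneg])
qed

definition csymbol :: "complex \<Rightarrow> complex" where
  "csymbol s = s powr of_real \<mu> * (1 + of_real \<phi> * s powr (- of_real \<rho>)) powr of_real \<gamma>"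

lemma Re_one_plus_pos:
  assumes "0 < Re s"
  shows "0 < Re (1 + of_real \<phi> * s powr (- of_real \<rho>))"
proof -
  have s: "s \<noteq> 0" using assms by auto
  have arg: "\<bar>Im (Ln s)\<bar> < pi / 2" using Re_Ln_pos_lt[OF s] assms by simp
  \<comment> \<open>As \<open>\<rho> \<le> 1\<close>, the argument of \<open>s powr - \<rho>\<close> stays within a quarter turn.\<close>
  have "\<bar>\<rho> * Im (Ln s)\<bar> \<le> 1 * \<bar>Im (Ln s)\<bar>"
    unfolding abs_mult using \<rho> by (intro mult_right_mono) auto
  then have "0 < cos (- \<rho> * Im (Ln s))"
    using arg by (intro cos_gt_zero_pi) (auto simp: abs_less_iff)
  moreover have "Re (s powr (- of_real \<rho>)) = exp (- \<rho> * Re (Ln s)) * cos (- \<rho> * Im (Ln s))"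
    using s by (simp add: powr_def Re_exp)
  ultimately have "0 < Re (s powr (- of_real \<rho>))" by (simp add: zero_less_mult_iff)
  then show ?thesis using \<phi> by (simp add: add_pos_nonneg)
qed

text \<open>
  In the right half-plane the bases of all the powers have positive real part, so no branch cut is
  met.
\<close>

lemma csymbol_holomorphic: "csymbol holomorphic_on {s. 0 < Re s}"
proof -
  have 1: "s \<notin> \<real>\<^sub>\<le>\<^sub>0" if "0 < Re s" for s :: complex
    using that by (auto simp: complex_nonpos_Reals_iff)
  have 2: "1 + of_real \<phi> * s powr (- of_real \<rho>) \<notin> \<real>\<^sub>\<le>\<^sub>0" if "0 < Re s" for s :: complex
    by (rule 1[OF Re_one_plus_pos[OF that]])
  show ?thesis
    unfolding csymbol_def[abs_def]
    by (intro holomorphic_intros) (simp_all only: mem_Collect_eq 1 2 not_False_eq_True)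
qed

lemma csymbol_of_real:
  assumes "0 < x"
  shows "csymbol (of_real x) = of_real (symbol x)"
proof -
  have "of_real x powr (- of_real \<rho> :: complex) = of_real (x powr - \<rho>)"
    using powr_of_real[of x "- \<rho>"] assms by simp
  then have "1 + of_real \<phi> * of_real x powr (- of_real \<rho>) = (of_real (1 + \<phi> * x powr - \<rho>) :: complex)"
    by simp
  moreover have "0 \<le> 1 + \<phi> * x powr - \<rho>" using \<phi> by (auto intro!: add_nonneg_nonneg)
  ultimately show ?thesis
    unfolding csymbol_def symbol_def using assms by (simp only: powr_of_real less_imp_le of_real_mult)
qed

definition claplace :: "complex \<Rightarrow> complex" where
  "claplace s = (\<integral>t. exp (- s * of_real t) * of_real (dens t) \<partial>pos_line)"

lemma claplace_of_real: "claplace (of_real x) = of_real (\<integral>t. exp (- x * t) * dens t \<partial>pos_line)"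
  unfolding claplace_def
  by (subst integral_complex_of_real[symmetric]) (simp add: exp_of_real[symmetric])

lemma claplace_holomorphic: "claplace holomorphic_on {s. 0 < Re s}"
proof (subst holomorphic_on_open[OF open_halfspace_Re_gt], rule ballI)
  fix s assume "s \<in> {s. 0 < Re s}"
  then have "0 < Re s" by simp
  from DERIV_laplace[OF exp_integrable_dens this, of s]
  show "\<exists>D. (claplace has_field_derivative D) (at s)"
    unfolding claplace_def[abs_def] by auto
qed

text \<open>
  Both sides are holomorphic in the right half-plane and agree on a real half-line. Stated as a
  product, the identity also yields that \<open>\<psi> + \<lambda>\<close> has no zero there.
\<close>

lemma claplace_eq:
  assumes s: "0 < Re s"
  shows "claplace s * (csymbol s + of_real lam) = of_real lam"
proof -
  obtain c where c: "0 < c" "exp_integrable c dens" "\<And>x. c < x \<Longrightarrow> (\<integral>t. exp (- x * t) * dens t \<partial>pos_line) = density_transform x"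
    by (rule laplace_dens_in_expansion_range) blast
  have "claplace s * (csymbol s + of_real lam) - of_real lam = 0"
  proof (rule analytic_continuation[where w = s
        and f = "\<lambda>s. claplace s * (csymbol s + of_real lam) - of_real lam" and S = "{s. 0 < Re s}" and U = "of_real ` {c<..}" and \<xi> = "of_real (c + 1)"])
    show "(\<lambda>s. claplace s * (csymbol s + of_real lam) - of_real lam) holomorphic_on {s. 0 < Re s}"
      by (intro holomorphic_intros claplace_holomorphic csymbol_holomorphic)
    show "connected {s. 0 < Re s}"
      by (intro convex_connected convex_halfspace_Re_gt)
    show "of_real ` {c<..} \<subseteq> {s. 0 < Re s}" using c by auto
    show "of_real (c + 1) \<in> {s. 0 < Re s}" using c by auto
    show "complex_of_real (c + 1) islimpt of_real ` {c<..}"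
    proof -
      define u where "u n = c + 1 + 1 / real (Suc n)" for n
      have "u \<longlonglongrightarrow> c + 1 + 0"
        unfolding u_def by (intro tendsto_intros LIMSEQ_Suc[OF lim_1_over_n])
      then have "(\<lambda>n. complex_of_real (u n)) \<longlonglongrightarrow> of_real (c + 1)"
        by (intro tendsto_of_real) simp
      moreover have "complex_of_real (u n) \<in> of_real ` {c<..} - {of_real (c + 1)}" for n
      proof -
        have "c + 1 < u n" by (simp add: u_def)
        then show ?thesis by (auto simp del: of_real_add)
      qed
      ultimately show ?thesis
        unfolding islimpt_sequential by (intro exI[of _ "\<lambda>n. complex_of_real (u n)"] conjI allI)
    qed
    show "claplace z * (csymbol z + of_real lam) - of_real lam = 0" if "z \<in> of_real ` {c<..}" for z
    proof -
      from that obtain x where x: "z = of_real x" "c < x" by auto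
      have "density_transform x * (symbol x + lam) = lam"
        using symbol_pos[of x] lam x c by (simp add: density_transform_def)
      then show ?thesis
        using x c by (simp add: claplace_of_real csymbol_of_real flip: of_real_add of_real_mult)
    qed
  qed (use s in \<open>auto simp: open_halfspace_Re_gt\<close>)
  then show ?thesis by simp
qed

lemma claplace_altdef:
  assumes s: "0 < Re s"
  shows "claplace s = of_real lam / (csymbol s + of_real lam)"
proof -
  have "csymbol s + of_real lam \<noteq> 0" using claplace_eq[OF s] lam by auto
  then show ?thesis using claplace_eq[OF s] by (simp add: field_simps)
qed

lemma laplace_dens:
  assumes x: "0 < x"
  shows "(\<integral>t. exp (- x * t) * dens t \<partial>pos_line) = density_transform x"
proof -
  have "complex_of_real (\<integral>t. exp (- x * t) * dens t \<partial>pos_line) = of_real (density_transform x)"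
    using claplace_altdef[of "of_real x"] x by (simp add: claplace_of_real csymbol_of_real density_transform_def)
  then show ?thesis by (simp only: of_real_eq_iff)
qed

lemma density_transform_tendsto_1: "(density_transform \<longlongrightarrow> 1) (at_right 0)"
proof -
  have "((\<lambda>s. lam / (symbol s + lam)) \<longlongrightarrow> lam / (0 + lam)) (at_right 0)"
    using lam by (intro tendsto_intros symbol_tendsto_0) auto
  then show ?thesis using lam by (simp add: density_transform_def[abs_def])
qed

text \<open>
  Monotone convergence along \<open>s = 1/(n+1)\<close>, where the transform tends to 1 because \<open>\<psi>\<close> tends to 0.
\<close>

lemma has_bochner_integral_dens: "has_bochner_integral lborel dens 1"
proof -
  let ?x = "\<lambda>n. 1 / real (Suc n)"
  have int: "integrable pos_line (\<lambda>t. exp (- ?x n * t) * dens t)" for n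
    by (rule exp_integrableD[OF exp_integrable_dens]) simp
  have mono: "AE t in pos_line. mono (\<lambda>n. exp (- ?x n * t) * dens t)"
    by (rule AE_I2) (auto intro!: monoI mult_right_mono dens_nonneg simp: frac_le)
  have nonneg: "AE t in pos_line. 0 \<le> exp (- ?x n * t) * dens t" for n
    by (rule AE_I2) (simp add: dens_nonneg)
  have lim: "AE t in pos_line. (\<lambda>n. exp (- ?x n * t) * dens t) \<longlonglongrightarrow> dens t"
  proof (rule AE_I2)
    fix t
    have "(\<lambda>n. exp (- ?x n * t) * dens t) \<longlonglongrightarrow> exp (- 0 * t) * dens t"
      by (intro tendsto_intros LIMSEQ_Suc[OF lim_1_over_n])
    then show "(\<lambda>n. exp (- ?x n * t) * dens t) \<longlonglongrightarrow> dens t" by simp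
  qed
  have ilim: "(\<lambda>n. \<integral>t. exp (- ?x n * t) * dens t \<partial>pos_line) \<longlonglongrightarrow> 1"
  proof -
    have "filterlim ?x (at_right 0) sequentially"
      by (rule tendsto_imp_filterlim_at_right[OF LIMSEQ_Suc[OF lim_1_over_n]]) simp
    from filterlim_compose[OF density_transform_tendsto_1 this] show ?thesis
      by (subst laplace_dens) auto
  qed
  have m: "dens \<in> borel_measurable pos_line"
    using exp_integrable_dens by (rule exp_integrable_measurable)
  have "has_bochner_integral pos_line dens 1"
    using integral_monotone_convergence_nonneg[OF int mono nonneg lim ilim m]
    by (simp add: has_bochner_integral_iff)
  moreover have "indicator {0<..} t *\<^sub>R dens t = dens t" for t
    using dens_eq_0[of t] by (auto simp: indicator_def)
  ultimately show ?thesis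
    by (subst (asm) has_bochner_integral_restrict_space) (simp_all only:, simp)
qed

end

section \<open>The renewal process\<close>

lemma nn_integral_exp_tail_pos_line:
  fixes a x :: real
  assumes "0 \<le> a" "0 < x"
  shows "(\<integral>\<^sup>+t. (if a \<le> t then ennreal (exp (- x * t)) else 0) \<partial>pos_line) = ennreal (exp (- x * a) / x)"
proof -
  have "(\<integral>\<^sup>+t. (if a \<le> t then ennreal (exp (- x * t)) else 0) \<partial>pos_line) =
      (\<integral>\<^sup>+t. (if a \<le> t then ennreal (exp (- x * t)) else 0) * indicator {0<..} t \<partial>lborel)"
    by (subst nn_integral_restrict_space) auto
  also have "\<dots> = (\<integral>\<^sup>+t. ennreal (exp (- x * t)) * indicator {a..} t \<partial>lborel)"
  proof (rule nn_integral_cong_AE)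
    \<comment> \<open>The integrands differ at most at \<open>t = 0\<close>, namely when \<open>a = 0\<close>.\<close>
    show "AE t in lborel. (if a \<le> t then ennreal (exp (- x * t)) else 0) * indicator {0<..} t =
        ennreal (exp (- x * t)) * indicator {a..} t"
      using AE_lborel_singleton[of 0] by eventually_elim (use assms in \<open>auto simp: indicator_def\<close>)
  qed
  also have "\<dots> = ennreal (0 - (- exp (- x * a) / x))"
  proof (rule nn_integral_FTC_atLeast)
    have "((\<lambda>t. - exp (- x * t) / x) \<longlongrightarrow> - 0 / x) at_top"
    proof (intro tendsto_intros)
      have "filterlim (\<lambda>t. - x * t) at_bot at_top"
        using assms by (intro filterlim_tendsto_neg_mult_at_bot[OF tendsto_const _ filterlim_ident]) auto
      then show "((\<lambda>t. exp (- x * t)) \<longlongrightarrow> 0) at_top"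
        by (rule filterlim_compose[OF exp_at_bot])
    qed (use assms in auto)
    then show "((\<lambda>t. - exp (- x * t) / x) \<longlongrightarrow> 0) at_top" by simp
    show "((\<lambda>t. - exp (- x * t) / x) has_real_derivative exp (- x * t)) (at t)" for t
      using assms by (auto intro!: derivative_eq_intros)
  qed auto
  finally show ?thesis by simp
qed

text \<open>
  The set of admissible indices contains 0 since \<open>t \<ge> 0\<close>, so its supremum is attained whenever it
  is finite. All later indices are excluded explicitly because the renewal times increase only
  almost surely.
\<close>

lemma renewal_count_eq_iff:
  assumes "0 \<le> t"
  shows "renewal_count T t \<omega> = enat k \<longleftrightarrow> renewal_time T k \<omega> \<le> t \<and> (\<forall>m>k. \<not> renewal_time T m \<omega> \<le> t)"
proof
  let ?A = "{m. renewal_time T m \<omega> \<le> t}"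
  assume eq: "renewal_count T t \<omega> = enat k"
  have ub: "m \<le> k" if "m \<in> ?A" for m
    using SUP_upper[OF that, of enat] eq by (simp add: renewal_count_def)
  have "k \<in> ?A"
  proof (rule ccontr)
    assume k: "k \<notin> ?A"
    have "0 \<in> ?A" using assms by (simp add: renewal_time_def)
    then have "k \<noteq> 0" using k by metis
    have "enat k \<le> enat (k - 1)"
      unfolding eq[symmetric] renewal_count_def
    proof (rule SUP_least)
      fix m assume "m \<in> ?A"
      with ub[of m] k have "m \<noteq> k" "m \<le> k" by auto
      then show "enat m \<le> enat (k - 1)" by simp
    qed
    then show False using \<open>k \<noteq> 0\<close> by simp
  qed
  then show "renewal_time T k \<omega> \<le> t \<and> (\<forall>m>k. \<not> renewal_time T m \<omega> \<le> t)"
    using ub by force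
next
  assume *: "renewal_time T k \<omega> \<le> t \<and> (\<forall>m>k. \<not> renewal_time T m \<omega> \<le> t)"
  show "renewal_count T t \<omega> = enat k"
    unfolding renewal_count_def
  proof (rule antisym)
    show "(SUP m\<in>{m. renewal_time T m \<omega> \<le> t}. enat m) \<le> enat k"
      using * by (intro SUP_least) (auto simp: not_less[symmetric])
    show "enat k \<le> (SUP m\<in>{m. renewal_time T m \<omega> \<le> t}. enat m)"
      using * by (intro SUP_upper) auto
  qed
qed

lemma renewal_count_mono: "s \<le> t \<Longrightarrow> renewal_count T s \<omega> \<le> renewal_count T t \<omega>"
  unfolding renewal_count_def by (rule SUP_subset_mono) auto

lemma renewal_time_Suc: "renewal_time T (Suc k) \<omega> = T (Suc k) \<omega> + renewal_time T k \<omega>"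
  by (simp add: renewal_time_def add.commute)

locale gfpp_renewal = gfpp_params +
  fixes M :: "'a measure" and T :: "nat \<Rightarrow> 'a \<Rightarrow> real"
  assumes iid: "iid_waiting_times (waiting_density lam \<phi> \<gamma> \<rho> \<mu>) M T"

sublocale gfpp_renewal \<subseteq> prob_space M
  using iid by (simp add: iid_waiting_times_def)

context gfpp_renewal
begin

abbreviation S :: "nat \<Rightarrow> 'a \<Rightarrow> real" where
  "S \<equiv> renewal_time T"

lemma indep: "indep_vars (\<lambda>_. borel) T {1..}"
  using iid by (simp add: iid_waiting_times_def)

lemma distributed_T: "1 \<le> j \<Longrightarrow> distributed M lborel (T j) (\<lambda>t. ennreal (dens t))"
  using iid by (simp add: iid_waiting_times_def)

lemma measurable_T: "1 \<le> j \<Longrightarrow> T j \<in> borel_measurable M"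
  using distributed_measurable[OF distributed_T, of j] by simp

lemma measurable_S [measurable]: "S k \<in> borel_measurable M"
  unfolding renewal_time_def[abs_def] by (intro borel_measurable_sum measurable_T) auto

lemma AE_T_pos: "AE \<omega> in M. \<forall>j\<ge>1. 0 < T j \<omega>"
proof -
  have "AE \<omega> in M. 1 \<le> j \<longrightarrow> 0 < T j \<omega>" for j
  proof (cases "1 \<le> j")
    case True
    have "AE \<omega> in M. 0 < T j \<omega>"
      by (subst distributed_AE2[OF distributed_T[OF True], of "\<lambda>t. 0 < t"])
         (use dens_eq_0 in \<open>auto simp: not_le[symmetric] intro!: AE_I2\<close>)
    then show ?thesis by simp
  qed simp
  then show ?thesis by (simp add: AE_all_countable)
qed

lemma AE_S_mono: "AE \<omega> in M. mono (\<lambda>k. S k \<omega>)"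
  using AE_T_pos
proof eventually_elim
  case (elim \<omega>)
  show ?case
    by (rule mono_iff_le_Suc[THEN iffD2]) (use elim in \<open>auto simp: renewal_time_Suc less_imp_le\<close>)
qed

lemma AE_S_nonneg: "AE \<omega> in M. \<forall>k. 0 \<le> S k \<omega>"
  using AE_S_mono
proof eventually_elim
  case (elim \<omega>)
  then show ?case using monoD[OF elim, of 0] by (simp add: renewal_time_def)
qed

lemma expectation_T:
  fixes g :: "real \<Rightarrow> 'b::{banach, second_countable_topology}"
  assumes j: "1 \<le> j" and [measurable]: "g \<in> borel_measurable borel"
  shows "(\<integral>\<omega>. g (T j \<omega>) \<partial>M) = (\<integral>t. dens t *\<^sub>R g t \<partial>pos_line)"
proof -
  have T: "T j \<in> measurable M lborel" using measurable_T[OF j] by simp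
  have pos: "0 < t" if "dens t \<noteq> 0" for t using dens_eq_0[of t] that by force
  have d: "dens \<in> borel_measurable lborel"
    using has_bochner_integral_dens by (auto simp: has_bochner_integral_iff)
  have "(\<integral>\<omega>. g (T j \<omega>) \<partial>M) = (\<integral>t. g t \<partial>distr M lborel (T j))"
    by (rule integral_distr[symmetric, OF T]) simp
  also have "\<dots> = (\<integral>t. g t \<partial>density lborel (\<lambda>t. ennreal (dens t)))"
    using distributed_distr_eq_density[OF distributed_T[OF j]] by simp
  also have "\<dots> = (\<integral>t. dens t *\<^sub>R g t \<partial>lborel)"
    by (rule integral_density) (use d dens_nonneg in auto)
  also have "\<dots> = (\<integral>t. indicator {0<..} t *\<^sub>R (dens t *\<^sub>R g t) \<partial>lborel)"
    by (rule Bochner_Integration.integral_cong) (use pos in \<open>auto simp: indicator_def\<close>)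
  also have "\<dots> = (\<integral>t. dens t *\<^sub>R g t \<partial>pos_line)"
    by (rule integral_restrict_space[symmetric]) simp
  finally show ?thesis .
qed

lemma laplace_T:
  assumes "1 \<le> j" "0 < Re s"
  shows "(\<integral>\<omega>. exp (- s * of_real (T j \<omega>)) \<partial>M) = of_real lam / (csymbol s + of_real lam)"
proof -
  have "(\<lambda>t. exp (- s * of_real t)) \<in> borel_measurable borel"
    by (intro borel_measurable_continuous_onI continuous_intros)
  from expectation_T[OF assms(1) this] show ?thesis
    using claplace_altdef[OF assms(2)] by (simp add: claplace_def scaleR_conv_of_real mult.commute)
qed

lemma laplace_T_real:
  assumes j: "1 \<le> j" and x: "0 < x"
  shows "(\<integral>\<omega>. exp (- x * T j \<omega>) \<partial>M) = density_transform x"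
    and "integrable M (\<lambda>\<omega>. exp (- x * T j \<omega>))"
proof -
  have m: "(\<lambda>t. exp (- x * t)) \<in> borel_measurable borel" by simp
  show "(\<integral>\<omega>. exp (- x * T j \<omega>) \<partial>M) = density_transform x"
    using expectation_T[OF j m] laplace_dens[OF x] by (simp add: mult.commute)
  have "integrable pos_line (\<lambda>t. exp (- x * t) * dens t)"
    by (rule exp_integrableD[OF exp_integrable_dens x])
  then have "integrable lborel (\<lambda>t. indicator {0<..} t *\<^sub>R (exp (- x * t) * dens t))"
    by (subst (asm) integrable_restrict_space) auto
  moreover have "indicator {0<..} t *\<^sub>R (exp (- x * t) * dens t) = dens t * exp (- x * t)" for t
    using dens_eq_0[of t] by (auto simp: indicator_def)
  ultimately have "integrable lborel (\<lambda>t. dens t * exp (- x * t))" by (simp only:)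
  then show "integrable M (\<lambda>\<omega>. exp (- x * T j \<omega>))"
    by (subst (asm) distributed_integrable[OF distributed_T[OF j]]) (auto simp: dens_nonneg)
qed

lemma laplace_S:
  assumes x: "0 < x"
  shows "(\<integral>\<omega>. exp (- x * S k \<omega>) \<partial>M) = density_transform x ^ k"
    and "integrable M (\<lambda>\<omega>. exp (- x * S k \<omega>))"
proof -
  have ind: "indep_vars (\<lambda>_. borel) (\<lambda>j \<omega>. exp (- x * T j \<omega>)) {1..k}"
    by (rule indep_vars_compose2[where M' = "\<lambda>_. borel" and Y = "\<lambda>_ t. exp (- x * t)" and X = T])
       (auto intro: indep_vars_subset[OF indep])
  have eq: "exp (- x * S k \<omega>) = (\<Prod>j\<in>{1..k}. exp (- x * T j \<omega>))" for \<omega>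
    by (simp add: renewal_time_def exp_sum sum_distrib_left sum_negf[symmetric])
  have int: "integrable M (\<lambda>\<omega>. exp (- x * T j \<omega>))" if "j \<in> {1..k}" for j
    using laplace_T_real(2)[OF _ x] that by simp
  show "(\<integral>\<omega>. exp (- x * S k \<omega>) \<partial>M) = density_transform x ^ k"
  proof -
    have "(\<integral>\<omega>. exp (- x * S k \<omega>) \<partial>M) = (\<Prod>j\<in>{1..k}. \<integral>\<omega>. exp (- x * T j \<omega>) \<partial>M)"
      unfolding eq by (rule indep_vars_lebesgue_integral[OF _ ind int]) auto
    also have "\<dots> = (\<Prod>j\<in>{1..k}. density_transform x)"
      by (intro prod.cong refl laplace_T_real(1) x) auto
    finally show ?thesis by simp
  qed
  show "integrable M (\<lambda>\<omega>. exp (- x * S k \<omega>))"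
    unfolding eq by (rule indep_vars_integrable[OF _ ind int]) auto
qed

definition cdf_S :: "nat \<Rightarrow> real \<Rightarrow> real" where
  "cdf_S k t = prob {\<omega> \<in> space M. S k \<omega> \<le> t}"

lemma mono_cdf_S: "mono (cdf_S k)"
  unfolding cdf_S_def by (intro monoI finite_measure_mono) auto

text \<open>
  By Fubini this is the expectation of the integral of \<open>exp (- x * t)\<close> over \<open>t \<ge> S\<^sub>k\<close>.
\<close>

lemma laplace_cdf_S:
  assumes x: "0 < x"
  shows "has_bochner_integral pos_line (\<lambda>t. exp (- x * t) * cdf_S k t) (density_transform x ^ k / x)"
proof (rule has_bochner_integral_nn_integral)
  have id [measurable]: "(\<lambda>t. t) \<in> borel_measurable pos_line"
    by (intro borel_measurable_pos_line continuous_intros)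
  have cdf_m: "cdf_S k \<in> borel_measurable borel"
    by (rule borel_measurable_mono[OF mono_cdf_S])
  have [measurable]: "cdf_S k \<in> borel_measurable pos_line"
    by (rule measurable_compose[OF id cdf_m])
  show "(\<lambda>t. exp (- x * t) * cdf_S k t) \<in> borel_measurable pos_line" by measurable
  have lt0: "0 \<le> density_transform x" using x lam symbol_pos[OF x] by (simp add: density_transform_def)
  then show "0 \<le> density_transform x ^ k / x" using x by simp
  show "AE t in pos_line. 0 \<le> exp (- x * t) * cdf_S k t" by (simp add: cdf_S_def)
  interpret pos: sigma_finite_measure pos_line
    by (rule sigma_finite_measure_restrict_space) (auto intro: lborel.sigma_finite_measure_axioms)
  interpret pair_sigma_finite M pos_line ..
  have "(\<integral>\<^sup>+t. ennreal (exp (- x * t) * cdf_S k t) \<partial>pos_line) =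
      (\<integral>\<^sup>+t. (\<integral>\<^sup>+\<omega>. (if S k \<omega> \<le> t then ennreal (exp (- x * t)) else 0) \<partial>M) \<partial>pos_line)"
  proof (rule nn_integral_cong)
    fix t
    have "(\<integral>\<^sup>+\<omega>. (if S k \<omega> \<le> t then ennreal (exp (- x * t)) else 0) \<partial>M) =
        (\<integral>\<^sup>+\<omega>. ennreal (exp (- x * t)) * indicator {\<omega> \<in> space M. S k \<omega> \<le> t} \<omega> \<partial>M)"
      by (rule nn_integral_cong) (auto simp: indicator_def)
    also have "\<dots> = ennreal (exp (- x * t)) * emeasure M {\<omega> \<in> space M. S k \<omega> \<le> t}"
      by (rule nn_integral_cmult_indicator) simp
    also have "\<dots> = ennreal (exp (- x * t) * cdf_S k t)"
      by (simp add: emeasure_eq_measure cdf_S_def ennreal_mult')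
    finally show "ennreal (exp (- x * t) * cdf_S k t) =
        (\<integral>\<^sup>+\<omega>. (if S k \<omega> \<le> t then ennreal (exp (- x * t)) else 0) \<partial>M)" by simp
  qed
  also have "\<dots> = (\<integral>\<^sup>+\<omega>. (\<integral>\<^sup>+t. (if S k \<omega> \<le> t then ennreal (exp (- x * t)) else 0) \<partial>pos_line) \<partial>M)"
    by (rule Fubini') measurable
  also have "\<dots> = (\<integral>\<^sup>+\<omega>. ennreal (exp (- x * S k \<omega>) / x) \<partial>M)"
  proof (rule nn_integral_cong_AE)
    show "AE \<omega> in M. (\<integral>\<^sup>+t. (if S k \<omega> \<le> t then ennreal (exp (- x * t)) else 0) \<partial>pos_line) =
        ennreal (exp (- x * S k \<omega>) / x)"
      using AE_S_nonneg by eventually_elim (simp only: nn_integral_exp_tail_pos_line[OF _ x])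
  qed
  also have "\<dots> = ennreal (\<integral>\<omega>. exp (- x * S k \<omega>) / x \<partial>M)"
    using laplace_S(2)[OF x] x by (intro nn_integral_eq_integral) auto
  also have "\<dots> = ennreal (density_transform x ^ k / x)"
    using laplace_S(1)[OF x] by simp
  finally show "(\<integral>\<^sup>+t. ennreal (exp (- x * t) * cdf_S k t) \<partial>pos_line) = ennreal (density_transform x ^ k / x)" .
qed

text \<open>
  Only the existence of a density matters: it rules out atoms.
\<close>

lemma distributed_S: "\<exists>h. distributed M lborel (S (Suc k)) h"
proof (induction k)
  case 0
  have "S (Suc 0) = T 1" by (auto simp: renewal_time_def)
  then show ?case using distributed_T[of 1] by auto
next
  case (Suc k)
  then obtain h where h: "distributed M lborel (S (Suc k)) h" by blast
  have "indep_var borel (T (Suc (Suc k))) borel (\<lambda>\<omega>. \<Sum>j\<in>{1..Suc k}. T j \<omega>)"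
    by (rule indep_vars_sum) (auto intro: indep_vars_subset[OF indep])
  then have "indep_var borel (T (Suc (Suc k))) borel (S (Suc k))"
    by (simp add: renewal_time_def[abs_def])
  from distributed_convolution[OF this distributed_T h]
  have "\<exists>h. distributed M lborel (\<lambda>\<omega>. T (Suc (Suc k)) \<omega> + S (Suc k) \<omega>) h" by auto
  moreover have "S (Suc (Suc k)) = (\<lambda>\<omega>. T (Suc (Suc k)) \<omega> + S (Suc k) \<omega>)"
    by (rule ext) (rule renewal_time_Suc)
  ultimately show ?case by simp
qed

lemma prob_S_eq:
  assumes "0 < t \<or> 1 \<le> k"
  shows "prob {\<omega> \<in> space M. S k \<omega> = t} = 0"
proof (cases k)
  case 0
  then show ?thesis using assms by (simp add: renewal_time_def)
next
  case (Suc m)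
  obtain h where h: "distributed M lborel (S k) h" using distributed_S Suc by blast
  have "emeasure M (S k -` {t} \<inter> space M) = (\<integral>\<^sup>+u. h u * indicator {t} u \<partial>lborel)"
    by (rule distributed_emeasure[OF h]) simp
  also have "\<dots> = (\<integral>\<^sup>+u. 0 \<partial>(lborel :: real measure))"
  proof (rule nn_integral_cong_AE)
    show "AE u in lborel. h u * indicator {t} u = 0"
      using AE_lborel_singleton[of t] by eventually_elim auto
  qed
  finally have "emeasure M (S k -` {t} \<inter> space M) = 0" by simp
  moreover have "S k -` {t} \<inter> space M = {\<omega> \<in> space M. S k \<omega> = t}" by auto
  ultimately show ?thesis by (simp add: measure_def)
qed

lemma prob_S_less:
  assumes "0 < t \<or> 1 \<le> k"
  shows "prob {\<omega> \<in> space M. S k \<omega> < t} = cdf_S k t"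
proof -
  have "cdf_S k t = prob ({\<omega> \<in> space M. S k \<omega> < t} \<union> {\<omega> \<in> space M. S k \<omega> = t})"
    unfolding cdf_S_def by (rule arg_cong[where f = prob]) auto
  also have "\<dots> = prob {\<omega> \<in> space M. S k \<omega> < t} + prob {\<omega> \<in> space M. S k \<omega> = t}"
    by (rule finite_measure_Union) auto
  finally show ?thesis by (simp add: prob_S_eq[OF assms])
qed

lemma isCont_cdf_S:
  assumes "0 < t"
  shows "isCont (cdf_S k) t"
proof -
  interpret D: real_distribution "distr M borel (S k)"
    by (rule real_distribution_distr) simp
  have vim: "S k -` {t} \<inter> space M = {\<omega> \<in> space M. S k \<omega> = t}" by auto
  have "isCont (cdf (distr M borel (S k))) t"
    unfolding D.isCont_cdf using prob_S_eq[of t k] assms by (subst measure_distr) (auto simp: vim)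
  moreover have "cdf (distr M borel (S k)) = cdf_S k"
  proof
    fix u
    have "S k -` {..u} \<inter> space M = {\<omega> \<in> space M. S k \<omega> \<le> u}" by auto
    then show "cdf (distr M borel (S k)) u = cdf_S k u"
      unfolding cdf_def cdf_S_def by (subst measure_distr) auto
  qed
  ultimately show ?thesis by simp
qed

lemma cdf_S_nonpos:
  assumes "t \<le> 0" "1 \<le> k"
  shows "cdf_S k t = 0"
proof -
  have "AE \<omega> in M. 0 < S k \<omega>"
    using AE_T_pos
  proof eventually_elim
    case (elim \<omega>)
    then show ?case using assms(2) unfolding renewal_time_def by (intro sum_pos) auto
  qed
  then have "AE \<omega> in M. \<omega> \<notin> {\<omega> \<in> space M. S k \<omega> \<le> t}"
    by eventually_elim (use assms in auto)
  then have "prob {\<omega> \<in> space M. S k \<omega> \<le> t} = prob {}"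
    by (intro finite_measure_eq_AE) auto
  then show ?thesis by (simp add: cdf_S_def)
qed

lemma cdf_S_0: "0 \<le> t \<Longrightarrow> cdf_S 0 t = 1"
  by (simp add: cdf_S_def renewal_time_def prob_space)

text \<open>
  Both sides are continuous for \<open>t > 0\<close> and have the transform \<open>(F\<^sup>k - F\<^sup>k\<^sup>+\<^sup>1) / s\<close>. The case \<open>t = 0\<close>
  is outside the reach of the transform and is checked directly.
\<close>

lemma state_eq_cdf_diff:
  assumes t: "0 \<le> t"
  shows "state k t = cdf_S k t - cdf_S (Suc k) t"
proof (cases "t = 0")
  case True
  then show ?thesis
    by (cases k) (simp_all add: state_0 cdf_S_0 cdf_S_nonpos)
next
  case False
  then have t: "0 < t" using t by simp
  obtain c where c: "c > 0" "\<And>s. s > c \<Longrightarrow> in_expansion_range s" using eventually_in_expansion_range by blast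
  define g where "g t = state k t - (cdf_S k t - cdf_S (Suc k) t)" for t
  have hb: "has_bochner_integral pos_line (\<lambda>t. exp (- x * t) * g t) 0" if x: "c < x" for x
  proof -
    have x0: "0 < x" using c x by simp
    obtain B where "has_laplace x (state k) B ((density_transform x ^ k - density_transform x ^ Suc k) / x)"
      using has_laplace_state[OF c(2)[OF x]] by blast
    then have "has_bochner_integral pos_line (\<lambda>t. exp (- x * t) * state k t) ((density_transform x ^ k - density_transform x ^ Suc k) / x)"
      by (simp only: has_laplace_def has_bochner_integral_iff simp_thms)
    from has_bochner_integral_diff[OF this has_bochner_integral_diff[OF laplace_cdf_S[OF x0, of k] laplace_cdf_S[OF x0, of "Suc k"]]]
    have "has_bochner_integral pos_line (\<lambda>t. exp (- x * t) * g t)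
        ((density_transform x ^ k - density_transform x ^ Suc k) / x - (density_transform x ^ k / x - density_transform x ^ Suc k / x))"
      by (simp only: g_def right_diff_distrib)
    then show ?thesis by (simp add: diff_divide_distrib)
  qed
  have "g t = 0"
  proof (rule laplace_zero_imp_zero[OF _ _ t])
    show "exp_integrable c g"
      unfolding exp_integrable_def using hb by (auto simp: has_bochner_integral_iff)
    show "(\<integral>t. exp (- x * t) * g t \<partial>pos_line) = 0" if "c < x" for x
      using hb[OF that] by (rule has_bochner_integral_integral_eq)
    show "isCont g t"
      unfolding g_def by (intro continuous_intros isCont_state isCont_cdf_S t)
  qed
  then show ?thesis by (simp add: g_def)
qed

lemma measurable_renewal_count:
  assumes "0 \<le> t"
  shows "renewal_count T t \<in> measurable M (count_space UNIV)"
proof -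
  \<comment> \<open>Measurability of a supremum requires an index set that does not depend on the path.\<close>
  have "renewal_count T t = (\<lambda>\<omega>. SUP m\<in>UNIV. if S m \<omega> \<le> t then enat m else 0)"
  proof
    fix \<omega>
    show "renewal_count T t \<omega> = (SUP m\<in>UNIV. if S m \<omega> \<le> t then enat m else 0)"
      unfolding renewal_count_def
    proof (rule antisym)
      show "(SUP m\<in>{m. S m \<omega> \<le> t}. enat m) \<le> (SUP m\<in>UNIV. if S m \<omega> \<le> t then enat m else 0)"
        by (rule SUP_mono) (auto intro!: bexI)
      show "(SUP m\<in>UNIV. if S m \<omega> \<le> t then enat m else 0) \<le> (SUP m\<in>{m. S m \<omega> \<le> t}. enat m)"
        by (rule SUP_least) (auto intro: SUP_upper)
    qed
  qed
  also have "\<dots> \<in> measurable M (count_space UNIV)" by measurable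
  finally show ?thesis .
qed

lemma cdf_S_le: "cdf_S m t \<le> exp t * density_transform 1 ^ m"
proof -
  have "cdf_S m t = (\<integral>\<omega>. indicator {\<omega> \<in> space M. S m \<omega> \<le> t} \<omega> \<partial>M)"
    by (simp add: cdf_S_def)
  also have "\<dots> \<le> (\<integral>\<omega>. exp t * exp (- 1 * S m \<omega>) \<partial>M)"
  proof (rule integral_mono)
    show "integrable M (\<lambda>\<omega>. exp t * exp (- 1 * S m \<omega>))"
      using laplace_S(2)[of 1 m] by simp
    show "integrable M (indicator {\<omega> \<in> space M. S m \<omega> \<le> t} :: 'a \<Rightarrow> real)"
      by (intro integrable_real_indicator) (auto simp: emeasure_eq_measure)
    show "indicator {\<omega> \<in> space M. S m \<omega> \<le> t} \<omega> \<le> exp t * exp (- 1 * S m \<omega>)" for \<omega>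
      by (auto simp: indicator_def simp flip: exp_add)
  qed
  also have "\<dots> = exp t * density_transform 1 ^ m"
    using laplace_S(1)[of 1 m] by simp
  finally show ?thesis .
qed

text \<open>
  By Markov's inequality for \<open>exp (- S\<^sub>m)\<close>, the probability of \<open>S\<^sub>m \<le> n\<close> is at most \<open>e\<^sup>n F(1)\<^sup>m\<close>, and
  \<open>F(1) < 1\<close>.
\<close>

lemma AE_S_unbounded: "AE \<omega> in M. \<forall>n::nat. \<exists>m. real n < S m \<omega>"
proof -
  have "AE \<omega> in M. \<exists>m. real n < S m \<omega>" for n :: nat
  proof -
    let ?A = "{\<omega> \<in> space M. \<forall>m. S m \<omega> \<le> real n}"
    have lt1: "0 \<le> density_transform 1" "density_transform 1 < 1"
      using lam symbol_pos[of 1] by (auto simp: density_transform_def)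
    have "(\<lambda>m. exp (real n) * density_transform 1 ^ m) \<longlonglongrightarrow> exp (real n) * 0"
      using lt1 by (intro tendsto_mult_left LIMSEQ_realpow_zero)
    then have lim: "(\<lambda>m. exp (real n) * density_transform 1 ^ m) \<longlonglongrightarrow> 0" by simp
    have bound: "prob ?A \<le> exp (real n) * density_transform 1 ^ m" for m
    proof -
      have "prob ?A \<le> cdf_S m (real n)"
        unfolding cdf_S_def by (rule finite_measure_mono) auto
      also have "\<dots> \<le> exp (real n) * density_transform 1 ^ m" by (rule cdf_S_le)
      finally show ?thesis .
    qed
    have "prob ?A \<le> 0"
      by (rule tendsto_lowerbound[OF lim always_eventually[OF allI[OF bound]]]) simp
    then have "prob ?A = 0" by (simp add: measure_le_0_iff)
    then have "emeasure M ?A = 0" by (simp add: emeasure_eq_measure)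
    then show ?thesis
      by (intro AE_I[of _ _ ?A]) (auto simp: not_less)
  qed
  then show ?thesis by (simp add: AE_all_countable)
qed

lemma AE_renewal_count_finite: "AE \<omega> in M. \<forall>t\<ge>0. renewal_count T t \<omega> \<noteq> \<infinity>"
  using AE_S_unbounded AE_S_mono
proof eventually_elim
  case (elim \<omega>)
  show ?case
  proof (intro allI impI)
    fix t :: real
    obtain n :: nat where n: "t \<le> real n" using real_arch_simple by blast
    obtain m where m: "real n < S m \<omega>" using elim(1) by blast
    have "renewal_count T t \<omega> \<le> enat m"
      unfolding renewal_count_def
    proof (rule SUP_least)
      fix k assume "k \<in> {m. S m \<omega> \<le> t}"
      then have "S k \<omega> < S m \<omega>" using n m by simp
      then have "k \<le> m" using monoD[OF elim(2), of m k] by linarith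
      then show "enat k \<le> enat m" by simp
    qed
    then show "renewal_count T t \<omega> \<noteq> \<infinity>"
      using infinity_ileE by metis
  qed
qed

text \<open>
  Almost surely the renewal times increase, so \<open>S\<^sub>k \<le> t\<close> splits into the disjoint events \<open>N(t) = k\<close>
  and \<open>S\<^sub>k\<^sub>+\<^sub>1 \<le> t\<close>.
\<close>

lemma prob_renewal_count:
  assumes t: "0 \<le> t"
  shows "prob {\<omega> \<in> space M. renewal_count T t \<omega> = enat k} = state k t"
proof -
  let ?N = "{\<omega> \<in> space M. renewal_count T t \<omega> = enat k}"
  have N: "?N \<in> sets M"
    using measurable_renewal_count[OF t] by measurable
  have "cdf_S k t = prob (?N \<union> {\<omega> \<in> space M. S (Suc k) \<omega> \<le> t})"
    unfolding cdf_S_def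
  proof (rule finite_measure_eq_AE)
    show "AE \<omega> in M. \<omega> \<in> {\<omega> \<in> space M. S k \<omega> \<le> t} \<longleftrightarrow> \<omega> \<in> ?N \<union> {\<omega> \<in> space M. S (Suc k) \<omega> \<le> t}"
      using AE_S_mono
    proof eventually_elim
      case (elim \<omega>)
      have "S k \<omega> \<le> S (Suc k) \<omega>" by (rule monoD[OF elim]) simp
      moreover have "S (Suc k) \<omega> \<le> S m \<omega>" if "k < m" for m
        by (rule monoD[OF elim]) (use that in simp)
      ultimately show ?case
        by (auto simp: renewal_count_eq_iff[OF t]) force
    qed
  qed (use N in auto)
  also have "\<dots> = prob ?N + cdf_S (Suc k) t"
    unfolding cdf_S_def
    by (rule finite_measure_Union) (use N in \<open>auto simp: renewal_count_eq_iff[OF t]\<close>)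
  finally show ?thesis using state_eq_cdf_diff[OF t] by simp
qed

lemma is_gfpp_renewal_count: "is_gfpp lam \<phi> \<gamma> \<rho> \<mu> M (renewal_count T)"
  unfolding is_gfpp_def
  using prob_space_axioms measurable_renewal_count prob_renewal_count AE_renewal_count_finite
  by (auto simp: renewal_count_mono)

lemma state_eq_prob_less_diff:
  assumes "t > 0 \<or> t = 0 \<and> k \<ge> 1"
  shows "state k t = prob {\<omega> \<in> space M. S k \<omega> < t} - prob {\<omega> \<in> space M. S (k + 1) \<omega> < t}"
proof -
  have "prob {\<omega> \<in> space M. S k \<omega> < t} = cdf_S k t"
    "prob {\<omega> \<in> space M. S (Suc k) \<omega> < t} = cdf_S (Suc k) t"
    using assms by (intro prob_S_less; auto)+
  moreover have "state k t = cdf_S k t - cdf_S (Suc k) t"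
    using assms by (intro state_eq_cdf_diff) auto
  ultimately show ?thesis by simp
qed

end

text \<open>
  The coordinate projections on the countable product of the law with density \<open>f\<close>.
\<close>

lemma iid_waiting_times_exists:
  fixes f :: "real \<Rightarrow> real"
  assumes f: "has_bochner_integral lborel f 1" "\<And>t. 0 \<le> f t"
  shows "\<exists>(P :: (nat \<Rightarrow> real) measure) T. iid_waiting_times f P T"
proof -
  define D where "D = density lborel (\<lambda>t. ennreal (f t))"
  have fm [measurable]: "f \<in> borel_measurable borel"
    using f(1) by (auto simp: has_bochner_integral_iff)
  have sets_D [measurable_cong]: "sets D = sets borel" by (simp add: D_def)
  have space_D [simp]: "space D = UNIV" by (simp add: D_def)
  have "emeasure D (space D) = 1"
  proof -
    have "emeasure D (space D) = (\<integral>\<^sup>+t. ennreal (f t) \<partial>lborel)"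
      by (simp add: D_def emeasure_density)
    also have "\<dots> = ennreal 1"
      using f by (subst nn_integral_eq_integral) (auto simp: has_bochner_integral_iff)
    finally show ?thesis by simp
  qed
  then have D: "prob_space D" by (rule prob_spaceI)
  define P where "P = PiM (UNIV :: nat set) (\<lambda>_. D)"
  interpret P: prob_space P
    unfolding P_def by (rule prob_space_PiM) (rule D)
  have comp: "distr P D (\<lambda>\<omega>. \<omega> j) = D" for j
    unfolding P_def by (rule distr_PiM_component) (auto intro: D)
  have rv: "(\<lambda>\<omega>. \<omega> j) \<in> borel_measurable P" for j
  proof -
    have "(\<lambda>\<omega>. \<omega> j) \<in> measurable P D" unfolding P_def by measurable
    then show ?thesis by (simp cong: measurable_cong_sets add: sets_D)
  qed
  have distr_borel: "distr P borel (\<lambda>\<omega>. \<omega> j) = D" for j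
    using comp[of j] by (subst distr_cong[OF refl sets_D[symmetric] refl]) simp
  have "P.indep_vars (\<lambda>_. borel) (\<lambda>j \<omega>. \<omega> j) UNIV"
  proof (subst P.indep_vars_iff_distr_eq_PiM)
    have "sets (PiM UNIV (\<lambda>_. borel :: real measure)) = sets P"
      unfolding P_def by (intro sets_PiM_cong refl) (simp add: sets_D)
    then have "distr P (PiM UNIV (\<lambda>_. borel)) (\<lambda>\<omega>. \<omega>) = P"
      by (rule distr_id2)
    then show "distr P (PiM UNIV (\<lambda>_. borel)) (\<lambda>x. \<lambda>i\<in>UNIV. x i) = PiM UNIV (\<lambda>i. distr P borel (\<lambda>\<omega>. \<omega> i))"
      unfolding distr_borel by (simp add: restrict_def P_def)
  qed (use rv in auto)
  then have "P.indep_vars (\<lambda>_. borel) (\<lambda>j \<omega>. \<omega> j) {1..}"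
    by (rule P.indep_vars_subset) simp
  moreover have "distributed P lborel (\<lambda>\<omega>. \<omega> j) (\<lambda>t. ennreal (f t))" for j
  proof -
    have "distr P lborel (\<lambda>\<omega>. \<omega> j) = distr P borel (\<lambda>\<omega>. \<omega> j)"
      by (rule distr_cong) auto
    then show ?thesis
      using rv[of j] distr_borel[of j] by (simp add: distributed_def D_def)
  qed
  ultimately have "iid_waiting_times f P (\<lambda>j \<omega>. \<omega> j)"
    using P.prob_space_axioms by (simp add: iid_waiting_times_def)
  then show ?thesis by blast
qed

theorem mainTheorem6:
  fixes lam \<phi> \<gamma> \<rho> \<mu> :: real
  defines "f \<equiv> waiting_density lam \<phi> \<gamma> \<rho> \<mu>"
  assumes "lam > 0" and "\<phi> > 0" and "\<gamma> \<ge> 0" and "0 < \<rho>" and "\<rho> \<le> 1" and "0 < \<mu>" and "\<mu> < 1"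
    and "\<gamma> \<noteq> 0 \<longrightarrow> (\<forall>r::nat. int r \<le> \<lceil>\<gamma>\<rceil> \<longrightarrow>
           0 < \<mu> * of_int \<lceil>\<gamma>\<rceil> / \<gamma> - real r * \<rho> \<and> \<mu> * of_int \<lceil>\<gamma>\<rceil> / \<gamma> - real r * \<rho> < 1)"
  shows
    "(\<forall>t. f t \<ge> 0) \<and> integrable lborel f \<and> integral\<^sup>L lborel f = 1 \<and>
     (\<exists>(P :: (nat \<Rightarrow> real) measure) T. iid_waiting_times f P T) \<and>
     (\<forall>(M :: 'a measure) T. iid_waiting_times f M T \<longrightarrow>
        (\<forall>j\<ge>1. \<forall>s::complex. Re s > 0 \<and>
           norm (- of_real lam * s powr (- of_real \<mu>) *
                 (1 + of_real \<phi> * s powr (- of_real \<rho>)) powr (- of_real \<gamma>)) < 1 \<longrightarrow>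
           (\<integral>\<omega>. exp (- s * of_real (T j \<omega>)) \<partial>M) =
             of_real lam /
             (s powr of_real \<mu> * (1 + of_real \<phi> * s powr (- of_real \<rho>)) powr of_real \<gamma>
              + of_real lam)) \<and>
        is_gfpp lam \<phi> \<gamma> \<rho> \<mu> M (renewal_count T) \<and>
        (\<forall>(M' :: 'b measure) N. is_gfpp lam \<phi> \<gamma> \<rho> \<mu> M' N \<longrightarrow>
           (\<forall>k t. t > 0 \<or> t = 0 \<and> k \<ge> 1 \<longrightarrow>
              measure M' {\<omega> \<in> space M'. N t \<omega> = enat k} =
                measure M {\<omega> \<in> space M. renewal_time T k \<omega> < t} -
                measure M {\<omega> \<in> space M. renewal_time T (k + 1) \<omega> < t})))"
proof -
  interpret gfpp_params lam \<phi> \<gamma> \<rho> \<mu>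
    by unfold_locales fact+
  have hb: "has_bochner_integral lborel f 1" and nonneg: "\<And>t. 0 \<le> f t"
    unfolding f_def using has_bochner_integral_dens dens_nonneg by auto
  show ?thesis
  proof (intro conjI allI impI)
    show "0 \<le> f t" for t by (rule nonneg)
    show "integrable lborel f" "integral\<^sup>L lborel f = 1"
      using hb by (auto simp: has_bochner_integral_iff)
    show "\<exists>(P :: (nat \<Rightarrow> real) measure) T. iid_waiting_times f P T"
      by (rule iid_waiting_times_exists[OF hb nonneg])
  next
    fix M :: "'a measure" and T
    assume "iid_waiting_times f M T"
    then interpret gfpp_renewal lam \<phi> \<gamma> \<rho> \<mu> M T
      by unfold_locales (simp add: f_def)
    show "(\<integral>\<omega>. exp (- s * of_real (T j \<omega>)) \<partial>M) =
             of_real lam /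
             (s powr of_real \<mu> * (1 + of_real \<phi> * s powr (- of_real \<rho>)) powr of_real \<gamma>
              + of_real lam)"
      if "1 \<le> j" "Re s > 0 \<and>
           norm (- of_real lam * s powr (- of_real \<mu>) *
                 (1 + of_real \<phi> * s powr (- of_real \<rho>)) powr (- of_real \<gamma>)) < 1" for j s
      using laplace_T[OF that(1), of s] that(2) by (simp add: csymbol_def)
    show "is_gfpp lam \<phi> \<gamma> \<rho> \<mu> M (renewal_count T)"
      by (rule is_gfpp_renewal_count)
    fix M' :: "'b measure" and N :: "real \<Rightarrow> 'b \<Rightarrow> enat" and k :: nat and t :: real
    assume "is_gfpp lam \<phi> \<gamma> \<rho> \<mu> M' N" and kt: "t > 0 \<or> t = 0 \<and> k \<ge> 1"
    then have "measure M' {\<omega> \<in> space M'. N t \<omega> = enat k} = state k t"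
      by (auto simp: is_gfpp_def)
    then show "measure M' {\<omega> \<in> space M'. N t \<omega> = enat k} =
                measure M {\<omega> \<in> space M. renewal_time T k \<omega> < t} -
                measure M {\<omega> \<in> space M. renewal_time T (k + 1) \<omega> < t}"
      using state_eq_prob_less_diff[OF kt] by simp
  qed
qed

end
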